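(* Let $r>1$ be an integer, let $q,p$ be nonzero complex numbers with $|p|<1$, and let $a_1,\dots,a_r$ be variables. Let $0\le M\le N$ be two integers, and let $n_1,\dots,n_r\in\mathbb N_0$ satisfy $n_1+\cdots+n_r=N$. Assume $\theta(q^m;p)\ne 0$ for all integers $1\le m\le N$. Write $K_i=\sum_{\nu=1}^ik_\nu$ and $N_i=\sum_{\nu=1}^in_\nu$ for $0\le i\le r$. Then, as an identity of meromorphic functions in $a_1,\dots,a_r\in\mathbb C\setminus\{0\}$, $$\begin{bmatrix}N\\ n_1,\dots,n_r\end{bmatrix}_{a_1,\dots,a_r;q,p}=\sum_{\substack{k_1,\dots,k_r\in\mathbb N_0\\ k_1+\cdots+k_r=M}}\Bigg(\begin{bmatrix}M\\ k_1,\dots,k_r\end{bmatrix}_{a_1,\dots,a_r;q,p}\begin{bmatrix}N-M\\ n_1-k_1,\dots,n_r-k_r\end{bmatrix}_{a_1q^{2M-k_1},\dots,a_rq^{2M-k_r};q,p}$$ $$\qquad\times\prod_{1\le i<j\le r}Q_{a_i,a_j;q,p}\big(n_i-k_i,\;N_{i-1}+K_{j-1}-K_i,\;k_i,\;k_j\big)\Bigg),$$ where the terms with $k_i>n_i$ for some $i$ are zero (the second elliptic multinomial coefficient being zero).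
   Context: Notation. For $x\in\mathbb C\setminus\{0\}$ and nonzero complex $p$ with $|p|<1$, let $(x;p)_\infty=\prod_{k\ge0}(1-xp^k)$ and let $\theta(x)=\theta(x;p)=(x;p)_\infty(p/x;p)_\infty$; $\theta(x_1,\dots,x_m)=\prod_{i=1}^m\theta(x_i)$. For an integer $k\ge0$, $(a;q,p)_k=\prod_{i=0}^{k-1}\theta(aq^i;p)$ (equal to $1$ for $k=0$). Elliptic multinomial coefficients. For non-negative integers $k_1,\dots,k_r$, with $K_i=\sum_{\nu=1}^ik_\nu$, $$\begin{bmatrix}k_1+\cdots+k_r\\ k_1,\dots,k_r\end{bmatrix}_{a_1,\dots,a_r;q,p}=\frac{(q;q,p)_{k_1+\cdots+k_r}}{\prod_{i=1}^r(q;q,p)_{k_i}}\prod_{i=1}^r\frac{(a_iq^{1+K_r-k_i};q,p)_{k_i}}{(a_iq^{1+2K_{i-1}};q,p)_{k_i}}\prod_{1\le i<j\le r}\frac{(a_iq^{1-k_i}/a_j;q,p)_{k_j}}{(a_iq/a_j;q,p)_{k_j}};$$ for integers $k_1,\dots,k_r$ with $k_1+\cdots+k_r\ge0$ and some $k_j<0$ the coefficient is $0$. Elliptic weights. For indeterminates $a,b$ and integers $s,t$, $$w_{a,b;q,p}(s,t)=\frac{\theta(aq^{s+2t},bq^{2s+t-2},aq^{t-s-1}/b)}{\theta(aq^{s+2t-2},bq^{2s+t},aq^{t-s+1}/b)}\,q,$$ and for $t\ge0$, $W_{a,b;q,p}(s,t)=\prod_{j=1}^tw_{a,b;q,p}(s,j)$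 (so $W_{a,b;q,p}(s,0)=1$). The shifted version is $W^{(\rho)}_{a,b;q,p}(s,t)=W_{aq^{2\rho},bq^{2\rho};q,p}(s,t)$. For $\ell\ge0$, the big $Q$-weights are $$Q_{a,b;q,p}(\ell,\rho,s,t)=\prod_{i=1}^{\ell}W^{(\rho)}_{a,b;q,p}(i+s,t).$$ *)

theory Defs
  imports "HOL-Analysis.Analysis"
begin

definition qpoch_inf :: "complex \<Rightarrow> complex \<Rightarrow> complex" where
  "qpoch_inf x p = (\<Prod>k. 1 - x * p ^ k)"

definition theta :: "complex \<Rightarrow> complex \<Rightarrow> complex" where
  "theta p x = qpoch_inf x p * qpoch_inf (p / x) p"

definition thetas :: "complex \<Rightarrow> complex list \<Rightarrow> complex" where
  "thetas p xs = prod_list (map (theta p) xs)"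

definition epoch :: "complex \<Rightarrow> complex \<Rightarrow> complex \<Rightarrow> nat \<Rightarrow> complex" where
  "epoch a q p k = (\<Prod>i<k. theta p (a * q ^ i))"

text \<open>
  Families with \<open>r\<close> members are functions on \<open>nat\<close> of which only the values at
  \<open>1, \<dots>, r\<close> matter.
\<close>

definition psum :: "(nat \<Rightarrow> int) \<Rightarrow> nat \<Rightarrow> int" where
  "psum k i = (\<Sum>\<nu>=1..i. k \<nu>)"

text \<open>
  The upper entry of the coefficient is not an argument, since it is always the sum
  \<open>psum k r\<close> of the lower entries.
\<close>

definition emultinom ::
  "nat \<Rightarrow> (nat \<Rightarrow> complex) \<Rightarrow> complex \<Rightarrow> complex \<Rightarrow> (nat \<Rightarrow> int) \<Rightarrow> complex" where
  "emultinom r a q p k =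
    (if \<exists>j\<in>{1..r}. k j < 0 then 0
     else
       epoch q q p (nat (psum k r)) / (\<Prod>i=1..r. epoch q q p (nat (k i)))
       * (\<Prod>i=1..r. epoch (a i * q powi (1 + psum k r - k i)) q p (nat (k i))
                   / epoch (a i * q powi (1 + 2 * psum k (i - 1))) q p (nat (k i)))
       * (\<Prod>j=1..r. \<Prod>i\<in>{1..<j}.
            epoch (a i * q powi (1 - k i) / a j) q p (nat (k j))
            / epoch (a i * q / a j) q p (nat (k j))))"

definition ew ::
  "complex \<Rightarrow> complex \<Rightarrow> complex \<Rightarrow> complex \<Rightarrow> int \<Rightarrow> int \<Rightarrow> complex" where
  "ew a b q p s t =
     thetas p [a * q powi (s + 2 * t), b * q powi (2 * s + t - 2), a * q powi (t - s - 1) / b]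
     / thetas p [a * q powi (s + 2 * t - 2), b * q powi (2 * s + t), a * q powi (t - s + 1) / b]
     * q"

definition eW ::
  "complex \<Rightarrow> complex \<Rightarrow> complex \<Rightarrow> complex \<Rightarrow> int \<Rightarrow> nat \<Rightarrow> complex" where
  "eW a b q p s t = (\<Prod>j=1..t. ew a b q p s (int j))"

definition eW_shift ::
  "int \<Rightarrow> complex \<Rightarrow> complex \<Rightarrow> complex \<Rightarrow> complex \<Rightarrow> int \<Rightarrow> nat \<Rightarrow> complex" where
  "eW_shift \<rho> a b q p s t = eW (a * q powi (2 * \<rho>)) (b * q powi (2 * \<rho>)) q p s t"

definition bigQ ::
  "complex \<Rightarrow> complex \<Rightarrow> complex \<Rightarrow> complex \<Rightarrow> nat \<Rightarrow> int \<Rightarrow> int \<Rightarrow> nat \<Rightarrow> complex" where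
  "bigQ a b q p l \<rho> s t = (\<Prod>i=1..l. eW_shift \<rho> a b q p (int i + s) t)"

text \<open>
  An identity of meromorphic functions is stated below as equality of values at every point at
  which no denominator that depends on \<open>a\<^sub>1, \<dots>, a\<^sub>r\<close> vanishes.  Each such denominator is a
  finite product of factors \<open>\<theta>(c x)\<close> with \<open>c \<noteq> 0\<close> and \<open>x\<close> one of \<open>a\<^sub>i\<close> and
  \<open>a\<^sub>i / a\<^sub>j\<close> (\<open>i < j\<close>), so it is holomorphic and not identically zero on
  \<open>(\<complex> - {0})\<^sup>r\<close>; the points excluded form a proper analytic subset, off which two meromorphic
  functions agree only if they are equal.  The predicates list these denominators factor by
  factor.  The remaining denominators \<open>(q;q,p)\<^sub>k\<close> do not depend on \<open>a\<^sub>1, \<dots>, a\<^sub>r\<close>.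
\<close>

definition emultinom_regular ::
  "nat \<Rightarrow> (nat \<Rightarrow> complex) \<Rightarrow> complex \<Rightarrow> complex \<Rightarrow> (nat \<Rightarrow> int) \<Rightarrow> bool" where
  "emultinom_regular r a q p k \<longleftrightarrow>
     (\<forall>i\<in>{1..r}. epoch (a i * q powi (1 + 2 * psum k (i - 1))) q p (nat (k i)) \<noteq> 0) \<and>
     (\<forall>j\<in>{1..r}. \<forall>i\<in>{1..<j}. epoch (a i * q / a j) q p (nat (k j)) \<noteq> 0)"

definition ew_regular ::
  "complex \<Rightarrow> complex \<Rightarrow> complex \<Rightarrow> complex \<Rightarrow> int \<Rightarrow> int \<Rightarrow> bool" where
  "ew_regular a b q p s t \<longleftrightarrow>
     thetas p [a * q powi (s + 2 * t - 2), b * q powi (2 * s + t), a * q powi (t - s + 1) / b] \<noteq> 0"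

definition bigQ_regular ::
  "complex \<Rightarrow> complex \<Rightarrow> complex \<Rightarrow> complex \<Rightarrow> nat \<Rightarrow> int \<Rightarrow> int \<Rightarrow> nat \<Rightarrow> bool" where
  "bigQ_regular a b q p l \<rho> s t \<longleftrightarrow>
     (\<forall>i\<in>{1..l}. \<forall>j\<in>{1..t}.
        ew_regular (a * q powi (2 * \<rho>)) (b * q powi (2 * \<rho>)) q p (int i + s) (int j))"

definition compositions :: "nat \<Rightarrow> nat \<Rightarrow> (nat \<Rightarrow> nat) set" where
  "compositions r M = {k \<in> {1..r} \<rightarrow>\<^sub>E UNIV. (\<Sum>i=1..r. k i) = M}"

lemma finite_compositions: "finite (compositions r M)"
proof (rule finite_subset)
  show "compositions r M \<subseteq> {1..r} \<rightarrow>\<^sub>E {0..M}"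
  proof
    fix k assume "k \<in> compositions r M"
    then have ext: "k \<in> {1..r} \<rightarrow>\<^sub>E UNIV" and sum: "(\<Sum>i=1..r. k i) = M"
      by (auto simp: compositions_def)
    have "k i \<le> M" if "i \<in> {1..r}" for i
      using member_le_sum[of i "{1..r}" k] that sum by simp
    with ext show "k \<in> {1..r} \<rightarrow>\<^sub>E {0..M}"
      by (auto simp: PiE_iff)
  qed
qed (intro finite_PiE; simp)

definition shifted_params ::
  "(nat \<Rightarrow> complex) \<Rightarrow> complex \<Rightarrow> nat \<Rightarrow> (nat \<Rightarrow> nat) \<Rightarrow> nat \<Rightarrow> complex" where
  "shifted_params a q M k i = a i * q powi (2 * int M - int (k i))"

text \<open>
  If \<open>k i > n i\<close> for some \<open>i\<close>, the truncated
  difference \<open>n i - k i\<close> makes the length of the corresponding big weights \<open>0\<close>; this is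
  harmless as the second multinomial coefficient is then \<open>0\<close>.
\<close>

definition conv_term ::
  "nat \<Rightarrow> (nat \<Rightarrow> complex) \<Rightarrow> complex \<Rightarrow> complex \<Rightarrow> nat \<Rightarrow> (nat \<Rightarrow> nat) \<Rightarrow> (nat \<Rightarrow> nat) \<Rightarrow> complex"
where
  "conv_term r a q p M n k =
     emultinom r a q p (\<lambda>i. int (k i))
     * emultinom r (shifted_params a q M k) q p (\<lambda>i. int (n i) - int (k i))
     * (\<Prod>j=1..r. \<Prod>i\<in>{1..<j}.
          bigQ (a i) (a j) q p (n i - k i)
            (psum (\<lambda>\<nu>. int (n \<nu>)) (i - 1) + psum (\<lambda>\<nu>. int (k \<nu>)) (j - 1)
               - psum (\<lambda>\<nu>. int (k \<nu>)) i)
            (int (k i)) (k j))"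

definition conv_term_regular ::
  "nat \<Rightarrow> (nat \<Rightarrow> complex) \<Rightarrow> complex \<Rightarrow> complex \<Rightarrow> nat \<Rightarrow> (nat \<Rightarrow> nat) \<Rightarrow> (nat \<Rightarrow> nat) \<Rightarrow> bool"
where
  "conv_term_regular r a q p M n k \<longleftrightarrow>
     emultinom_regular r a q p (\<lambda>i. int (k i)) \<and>
     emultinom_regular r (shifted_params a q M k) q p (\<lambda>i. int (n i) - int (k i)) \<and>
     (\<forall>j\<in>{1..r}. \<forall>i\<in>{1..<j}.
        bigQ_regular (a i) (a j) q p (n i - k i)
          (psum (\<lambda>\<nu>. int (n \<nu>)) (i - 1) + psum (\<lambda>\<nu>. int (k \<nu>)) (j - 1)
             - psum (\<lambda>\<nu>. int (k \<nu>)) i)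
          (int (k i)) (k j))"

end

theory Submission
  imports Defs "HOL-Complex_Analysis.Cauchy_Integral_Formula"
begin

text \<open>
  Fix \<open>n\<close>. Divided by the left-hand side, the summand for \<open>k\<close> becomes a quotient of theta
  functions, \<open>transition r a k n\<close>, in which the dependence on the order of the indices has
  disappeared: the big weights telescope, first in their last argument (\<open>eW_telescope\<close>), then
  in their length (\<open>bigQ_telescope\<close>), and finally over one index of the product over pairs, and what
  remains of them cancels against the order-dependent factors of the three multinomial
  coefficients (\<open>conv_term_generic\<close>). So the claim is that the numbers \<open>transition r a k n\<close> with
  \<open>|k| = M\<close> sum to \<open>1\<close>; this is a Jackson summation of type A.

  One can think of \<open>transition r a k n\<close> as the (complex-valued) probability that a random walk on lattice points, which starts
  at \<open>n\<close> and lowers one coordinate by \<open>1\<close> in each step, visits \<open>k\<close>. The weight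
  \<open>first_step r a k n m\<close> is then the conditional probability, given that the walk visits \<open>k\<close>, that
  its first step lowers the coordinate \<open>m\<close>, and \<open>transition_first_step\<close> is the multiplication rule for this. These
  conditional probabilities sum to \<open>1\<close> over \<open>m\<close> (\<open>sum_first_step\<close>), and from this the sum of the
  transition weights follows by induction on \<open>|n| - M\<close> (\<open>sum_transition\<close>).

  The identity for \<open>first_step\<close> is the elliptic partial fraction expansion
  \<open>theta_partial_fractions\<close>: if \<open>\<Prod>x\<^sub>i = \<Prod>y\<^sub>i\<close>, then
  \<open>\<Sum>\<^sub>m \<Prod>\<^sub>j \<theta>(x\<^sub>m/y\<^sub>j) / \<Prod>\<^bsub>j\<noteq>m\<^esub> \<theta>(x\<^sub>m/x\<^sub>j) = 0\<close>. It reduces to fewer points because the functions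
  \<open>f\<close>, holomorphic on \<open>\<complex> - {0}\<close>, with \<open>f(px) = Y f(x) / x\<^sup>2\<close> form a space of dimension two
  (\<open>theta2_span\<close>), which in turn is Liouville's theorem applied to the elliptic quotient of two
  such functions with the same zeros.

  All this is done for parameters at which no theta factor with an argument \<open>a\<^sub>i q\<^sup>s\<close> or
  \<open>a\<^sub>i q\<^sup>s / a\<^sub>j\<close> with \<open>i \<noteq> j\<close> vanishes, whatever the integer \<open>s\<close>. Such parameters occur
  arbitrarily close to every \<open>a\<close>, along the curve \<open>a\<^sub>i exp (i t)\<close>, and both sides are continuous
  where the listed denominators do not vanish.
\<close>

section \<open>The theta function\<close>

locale nome =
  fixes p :: complex
  assumes p_nonzero: "p \<noteq> 0" and norm_p_less_1: "norm p < 1"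
begin

lemma qpoch_inf_convergent: "convergent_prod (\<lambda>k. 1 - x * p ^ k)"
proof -
  have "summable (\<lambda>k. norm ((1 - x * p ^ k) - 1))"
    using norm_p_less_1
    by (simp add: norm_mult norm_power summable_mult summable_geometric)
  then show ?thesis
    by (intro abs_convergent_prod_imp_convergent_prod summable_imp_abs_convergent_prod)
qed

lemma qpoch_inf_has_prod: "(\<lambda>k. 1 - x * p ^ k) has_prod qpoch_inf x p"
  unfolding qpoch_inf_def by (rule convergent_prod_has_prod [OF qpoch_inf_convergent])

lemma qpoch_inf_eq_0_iff: "qpoch_inf x p = 0 \<longleftrightarrow> (\<exists>k. x * p ^ k = 1)"
  using has_prod_eq_0_iff [OF qpoch_inf_has_prod, of x] by (simp add: image_iff eq_diff_eq)

lemma qpoch_inf_shift: "qpoch_inf x p = (1 - x) * qpoch_inf (p * x) p"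
proof -
  have "(\<lambda>k. 1 - x * p ^ Suc k) has_prod qpoch_inf (p * x) p"
    using qpoch_inf_has_prod [of "p * x"] by (simp add: mult_ac)
  then have "(\<lambda>k. 1 - x * p ^ k) has_prod (qpoch_inf (p * x) p * (1 - x * p ^ 0))"
    by (rule has_prod_Suc_imp)
  then show ?thesis
    using has_prod_unique2 [OF qpoch_inf_has_prod] by (simp add: mult.commute)
qed

lemma qpoch_inf_holomorphic: "(\<lambda>x. qpoch_inf x p) holomorphic_on UNIV"
proof -
  define P where "P = (\<lambda>N x. \<Prod>k<N. 1 - x * p ^ k)"
  have lim: "uniform_limit (cball 0 R) P (\<lambda>x. qpoch_inf x p) sequentially" for R
  proof -
    have "uniformly_convergent_on (cball 0 R) P"
      unfolding P_def
    proof (rule uniformly_convergent_on_prod')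
      show "uniformly_convergent_on (cball 0 R) (\<lambda>N x. \<Sum>k<N. norm (1 - x * p ^ k - 1))"
      proof (rule Weierstrass_m_test')
        show "summable (\<lambda>k. R * norm p ^ k)"
          using norm_p_less_1 by (intro summable_mult summable_geometric) simp
      qed (auto simp: norm_mult norm_power intro!: mult_right_mono)
    qed (auto intro!: continuous_intros)
    then obtain g where g: "uniform_limit (cball 0 R) P g sequentially"
      by (auto simp: uniformly_convergent_on_def)
    have "g x = qpoch_inf x p" if "x \<in> cball 0 R" for x
    proof (rule tendsto_unique)
      show "(\<lambda>N. P N x) \<longlonglongrightarrow> g x"
        using tendsto_uniform_limitI [OF g that] .
      have "(\<lambda>N. P (Suc N) x) \<longlonglongrightarrow> qpoch_inf x p"
        using convergent_prod_LIMSEQ [OF qpoch_inf_convergent [of x]]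
        by (simp add: P_def lessThan_Suc_atMost qpoch_inf_def)
      then show "(\<lambda>N. P N x) \<longlonglongrightarrow> qpoch_inf x p"
        by (rule LIMSEQ_imp_Suc)
    qed auto
    then show ?thesis
      using g by (subst uniform_limit_cong'[where g = P and i = g]) auto
  qed
  have "(\<lambda>x. qpoch_inf x p) holomorphic_on ball 0 R" for R
    by (rule holomorphic_uniform_limit [OF _ lim [of R]])
       (auto simp: P_def intro!: always_eventually continuous_intros holomorphic_intros)
  then have "(\<lambda>x. qpoch_inf x p) holomorphic_on (\<Union>R. ball 0 R)"
    by (subst holomorphic_on_UN_open) auto
  moreover have "(\<Union>R. ball 0 R) = (UNIV :: complex set)"
  proof safe
    fix x :: complex
    show "x \<in> (\<Union>R. ball 0 R)"
      by (rule UN_I [of "norm x + 1"]) auto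
  qed auto
  ultimately show ?thesis
    by simp
qed

lemma theta_holomorphic: "theta p holomorphic_on - {0}"
proof -
  have "(\<lambda>x. qpoch_inf (p / x) p) holomorphic_on - {0}"
    by (rule holomorphic_on_compose_gen [OF _ qpoch_inf_holomorphic, unfolded o_def])
       (auto intro!: holomorphic_intros)
  then show ?thesis
    unfolding theta_def
    by (intro holomorphic_on_mult holomorphic_on_subset [OF qpoch_inf_holomorphic]) auto
qed

lemma theta_holomorphic_compose [holomorphic_intros]:
  assumes "f holomorphic_on S" "\<And>x. x \<in> S \<Longrightarrow> f x \<noteq> 0"
  shows "(\<lambda>x. theta p (f x)) holomorphic_on S"
  by (rule holomorphic_on_compose_gen [OF assms(1) theta_holomorphic, unfolded o_def])
     (use assms(2) in auto)

lemma theta_field_differentiable: "x \<noteq> 0 \<Longrightarrow> theta p field_differentiable at x"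
  using theta_holomorphic by (rule holomorphic_on_imp_differentiable_at) (auto simp: open_Compl)

lemma tendsto_theta [tendsto_intros]:
  assumes "(f \<longlongrightarrow> l) F" "l \<noteq> 0"
  shows "((\<lambda>t. theta p (f t)) \<longlongrightarrow> theta p l) F"
  using isCont_tendsto_compose [OF field_differentiable_imp_continuous_at
      [OF theta_field_differentiable [OF assms(2)]] assms(1)] .

lemma theta_p_mult: "x \<noteq> 0 \<Longrightarrow> theta p (p * x) = - theta p x / x"
  by (simp add: theta_def qpoch_inf_shift [of x] qpoch_inf_shift [of "1 / x"] p_nonzero field_simps)

lemma theta_inverse: "x \<noteq> 0 \<Longrightarrow> theta p (1 / x) = - theta p x / x"
  by (simp add: theta_def qpoch_inf_shift [of x] qpoch_inf_shift [of "1 / x"] p_nonzero field_simps)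

lemma theta_swap: "x \<noteq> 0 \<Longrightarrow> y \<noteq> 0 \<Longrightarrow> theta p (x / y) = - (x / y) * theta p (y / x)"
  using theta_inverse [of "y / x"] by (simp add: field_simps)

lemma theta_1 [simp]: "theta p 1 = 0"
  using qpoch_inf_shift [of 1] by (simp add: theta_def)

text \<open>
  Only the factors of the two infinite products can vanish, so the zeros of \<open>\<theta>\<close> are the
  integer powers of \<open>p\<close>.
\<close>

lemma theta_eq_0D:
  assumes "x \<noteq> 0" "theta p x = 0"
  shows "\<exists>k::int. x = p powi k"
proof -
  from assms(2) consider k where "x * p ^ k = 1" | k where "p / x * p ^ k = 1"
    by (auto simp: theta_def qpoch_inf_eq_0_iff)
  then show ?thesis
  proof cases
    case (1 k)
    then have "x = p powi (- int k)"
      using p_nonzero by (simp add: power_int_minus field_simps)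
    then show ?thesis ..
  next
    case (2 k)
    then have "x = p powi (int (Suc k))"
      using assms(1) by (auto simp: field_simps power_int_add p_nonzero)
    then show ?thesis ..
  qed
qed

lemma p_orbit_induct:
  assumes "P x" "x \<noteq> 0" "\<And>y. y \<noteq> 0 \<Longrightarrow> P (p * y) \<longleftrightarrow> P y"
  shows "P (p powi (k::int) * x)"
proof (induction k rule: int_induct [where k = 0])
  case (step1 i)
  then show ?case
    using assms(3) [of "p powi i * x"] assms(2) p_nonzero by (simp add: power_int_add mult_ac)
next
  case (step2 i)
  then show ?case
    using assms(3) [of "p powi (i - 1) * x"] assms(2) p_nonzero
    by (simp add: power_int_diff)
qed (use assms in simp)

lemma theta_orbit_eq_0_iff: "x \<noteq> 0 \<Longrightarrow> theta p (p powi k * x) = 0 \<longleftrightarrow> theta p x = 0"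
  by (rule p_orbit_induct [where P = "\<lambda>y. theta p y = 0 \<longleftrightarrow> theta p x = 0"])
     (auto simp: theta_p_mult)

text \<open>
  At \<open>1\<close> the zero is simple because the factor \<open>1 - x\<close> splits off; quasi-periodicity carries
  this to all other zeros.
\<close>

lemma deriv_theta_nonzero:
  assumes "x \<noteq> 0" "theta p x = 0"
  shows "deriv (theta p) x \<noteq> 0"
proof -
  define h where "h = (\<lambda>x. qpoch_inf (p * x) p * qpoch_inf (p / x) p)"
  have h1: "h 1 \<noteq> 0"
  proof
    assume "h 1 = 0"
    then obtain k where "p ^ Suc k = 1"
      by (auto simp: h_def qpoch_inf_eq_0_iff)
    then have "norm p ^ Suc k = 1"
      by (metis norm_one norm_power)
    then show False
      using power_less_one_iff [of "norm p" "Suc k"] norm_p_less_1 by simp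
  qed
  have h_hol: "h holomorphic_on - {0}"
    unfolding h_def
    by (intro holomorphic_on_mult holomorphic_on_compose_gen [OF _ qpoch_inf_holomorphic, unfolded o_def])
       (auto intro!: holomorphic_intros)
  then have h_deriv: "(h has_field_derivative deriv h 1) (at 1)"
    by (intro holomorphic_derivI [of _ "- {0}"]) (auto simp: open_Compl)
  have "((\<lambda>x. (1 - x) * h x) has_field_derivative (- h 1)) (at 1)"
    by (rule derivative_eq_intros h_deriv refl | simp)+
  moreover have "(\<lambda>x. (1 - x) * h x) = theta p"
    by (rule ext) (simp add: h_def theta_def mult.assoc [symmetric] flip: qpoch_inf_shift)
  ultimately have at_1: "deriv (theta p) 1 \<noteq> 0"
    using h1 by (simp add: DERIV_imp_deriv)
  define P where "P = (\<lambda>y. theta p y = 0 \<and> deriv (theta p) y \<noteq> 0)"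
  have step: "P (p * y) \<longleftrightarrow> P y" if y: "y \<noteq> 0" for y
  proof -
    note D = field_differentiable_derivI [OF theta_field_differentiable]
    have "((\<lambda>x. theta p (p * x)) has_field_derivative deriv (theta p) (p * y) * p) (at y)"
      using y p_nonzero by (auto intro!: DERIV_chain2 [OF D] derivative_eq_intros)
    moreover have "((\<lambda>x. - theta p x / x) has_field_derivative
        (- deriv (theta p) y * y - - theta p y * 1) / (y * y)) (at y)"
      by (intro DERIV_divide DERIV_minus D DERIV_ident y)
    then have "((\<lambda>x. theta p (p * x)) has_field_derivative
        (- deriv (theta p) y * y - - theta p y * 1) / (y * y)) (at y)"
      by (rule has_field_derivative_transform_within_open [of _ _ _ "- {0}"])
         (use y in \<open>auto simp: theta_p_mult open_Compl\<close>)
    ultimately have "deriv (theta p) (p * y) * p = (- deriv (theta p) y * y - - theta p y * 1) / (y * y)"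
      by (rule DERIV_unique)
    then have "deriv (theta p) (p * y) * p * y = - deriv (theta p) y" if "theta p y = 0"
      using y that by simp
    moreover have "theta p (p * y) = 0 \<longleftrightarrow> theta p y = 0"
      using y by (simp add: theta_p_mult)
    ultimately show ?thesis
      unfolding P_def using y p_nonzero
      by (metis mult_eq_0_iff neg_equal_0_iff_equal)
  qed
  from theta_eq_0D [OF assms] obtain k where "x = p powi k * 1"
    by auto
  moreover have "P (p powi k * 1)"
    by (rule p_orbit_induct [of P]) (use at_1 step in \<open>auto simp: P_def\<close>)
  ultimately show ?thesis
    by (simp add: P_def)
qed

end

section \<open>Theta functions of degree two\<close>

text \<open>
  At a simple zero of \<open>D\<close> that is also a zero of \<open>f\<close>, the singularity of \<open>f / D\<close> is removable, with value
  \<open>f' / D'\<close>.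
\<close>

lemma holomorphic_factor_simple_zeros:
  fixes f D :: "complex \<Rightarrow> complex"
  assumes "open S" and f: "f holomorphic_on S" and D: "D holomorphic_on S"
    and zeros: "\<And>x. x \<in> S \<Longrightarrow> D x = 0 \<Longrightarrow> f x = 0 \<and> deriv D x \<noteq> 0"
  obtains g where "g holomorphic_on S" "\<And>x. x \<in> S \<Longrightarrow> f x = g x * D x"
proof
  define g where "g = (\<lambda>x. if D x = 0 then deriv f x / deriv D x else f x / D x)"
  show "f x = g x * D x" if "x \<in> S" for x
    using zeros [OF that] by (auto simp: g_def)
  have "\<exists>T. open T \<and> x0 \<in> T \<and> g holomorphic_on T" if x0: "x0 \<in> S" for x0
  proof (cases "D x0 = 0")
    case False
    define T where "T = S \<inter> D -` (- {0})"
    have "open T"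
      unfolding T_def using D \<open>open S\<close>
      by (intro continuous_open_preimage holomorphic_on_imp_continuous_on) auto
    moreover have "g holomorphic_on T"
    proof (rule holomorphic_transform)
      show "(\<lambda>x. f x / D x) holomorphic_on T"
        using f D by (auto simp: T_def intro!: holomorphic_intros elim: holomorphic_on_subset)
    qed (auto simp: g_def T_def)
    ultimately show ?thesis
      using False x0 by (auto simp: T_def)
  next
    case True
    define q where "q = (\<lambda>h x. if x = x0 then deriv h x0 else (h x - h x0) / (x - x0) :: complex)"
    have q_f: "q f holomorphic_on S" and q_D: "q D holomorphic_on S"
      unfolding q_def using f D \<open>open S\<close> by (auto intro: pole_lemma_open)
    define T where "T = S \<inter> q D -` (- {0})"
    have "open T"
      unfolding T_def using q_D \<open>open S\<close>
      by (intro continuous_open_preimage holomorphic_on_imp_continuous_on) auto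
    moreover have "g holomorphic_on T"
    proof (rule holomorphic_transform)
      show "(\<lambda>x. q f x / q D x) holomorphic_on T"
        using q_f q_D by (auto simp: T_def intro!: holomorphic_intros elim: holomorphic_on_subset)
    next
      fix x assume "x \<in> T"
      then show "q f x / q D x = g x"
        using True zeros [OF x0] by (auto simp: T_def q_def g_def)
    qed
    moreover have "x0 \<in> T"
      using x0 True zeros [OF x0] by (auto simp: T_def q_def)
    ultimately show ?thesis
      by blast
  qed
  then show "g holomorphic_on S"
    by (metis at_within_open field_differentiable_at_within holomorphic_onI
        holomorphic_on_imp_differentiable_at)
qed

text \<open>
  The set of excluded parameters is countable, so it contains no interval; this transfers an
  identity from generic parameters to a given one.
\<close>

lemma eq_at_0_if_eq_off_countable:
  fixes f g :: "real \<Rightarrow> complex"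
  assumes "countable B" "\<And>t. t \<notin> B \<Longrightarrow> f t = g t"
    and "(f \<longlongrightarrow> f 0) (at 0)" "(g \<longlongrightarrow> g 0) (at 0)"
  shows "f 0 = g 0"
proof (rule ccontr)
  assume "f 0 \<noteq> g 0"
  moreover have "((\<lambda>t. f t - g t) \<longlongrightarrow> f 0 - g 0) (at 0)"
    by (intro tendsto_diff assms)
  ultimately have "eventually (\<lambda>t. f t - g t \<noteq> 0) (at 0)"
    by (intro tendsto_imp_eventually_ne) auto
  then obtain d where d: "d > 0" "\<And>t. t \<noteq> 0 \<Longrightarrow> \<bar>t\<bar> < d \<Longrightarrow> f t \<noteq> g t"
    by (auto simp: eventually_at dist_real_def)
  have "{0<..<d} \<subseteq> B"
    using d(2) assms(2) by force
  then have "countable {0<..<d}"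
    using assms(1) countable_subset by blast
  then show False
    using uncountable_open_interval [of 0 d] d(1) by blast
qed

context nome
begin

text \<open>
  The absolute value of a zero of \<open>\<theta>\<close> is an integer power of \<open>|p|\<close>, and \<open>|c| exp (s t)\<close> takes each of
  these at one \<open>t\<close> only.
\<close>

lemma countable_theta_exp_zeros:
  assumes "c \<noteq> 0" "s \<noteq> 0"
  shows "countable {t :: real. theta p (c * of_real (exp (s * t))) = 0}"
proof (rule countable_subset)
  show "{t. theta p (c * of_real (exp (s * t))) = 0}
      \<subseteq> (\<lambda>k::int. ln (norm (p powi k / c)) / s) ` UNIV"
  proof
    fix t assume "t \<in> {t. theta p (c * of_real (exp (s * t))) = 0}"
    then obtain k :: int where "c * of_real (exp (s * t)) = p powi k"
      using theta_eq_0D assms(1) by fastforce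
    then have "of_real (exp (s * t)) = p powi k / c"
      using assms(1) by (simp add: field_simps)
    then have "norm (p powi k / c) = exp (s * t)"
      by (metis abs_exp_cancel norm_of_real)
    then have "t = ln (norm (p powi k / c)) / s"
      using assms(2) by simp
    then show "t \<in> (\<lambda>k::int. ln (norm (p powi k / c)) / s) ` UNIV"
      by blast
  qed
qed auto

lemma norm_orbit_in_annulus:
  assumes "x \<noteq> 0"
  shows "\<exists>k::int. norm p \<le> norm (p powi k * x) \<and> norm (p powi k * x) \<le> 1"
proof -
  define L where "L = ln (norm p)"
  have L: "L < 0"
    using norm_p_less_1 p_nonzero by (simp add: L_def)
  define k where "k = \<lfloor>1 - ln (norm x) / L\<rfloor>"
  have "norm (p powi k * x) = norm p powr of_int k * norm x"
    using p_nonzero by (simp add: norm_mult norm_power_int powr_real_of_int')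
  then have "ln (norm (p powi k * x)) = of_int k * L + ln (norm x)"
    using assms p_nonzero by (simp add: ln_mult L_def ln_powr)
  moreover have "of_int k * L + ln (norm x) \<le> 0"
  proof -
    have "- ln (norm x) / L \<le> of_int k"
      unfolding k_def by linarith
    then show ?thesis
      using L by (simp add: field_simps)
  qed
  moreover have "L \<le> of_int k * L + ln (norm x)"
  proof -
    have "of_int k \<le> 1 - ln (norm x) / L"
      unfolding k_def by linarith
    then show ?thesis
      using L by (simp add: field_simps)
  qed
  ultimately have "ln (norm p) \<le> ln (norm (p powi k * x))" "ln (norm (p powi k * x)) \<le> ln 1"
    by (auto simp: L_def)
  moreover have "norm (p powi k * x) > 0"
    using assms p_nonzero by simp
  ultimately have "norm p \<le> norm (p powi k * x)" "norm (p powi k * x) \<le> 1"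
    using p_nonzero by (simp_all del: ln_one add: ln_le_cancel_iff)
  then show ?thesis
    by blast
qed

text \<open>
  Such a function takes all its values on a compact annulus, so Liouville's theorem applies to its
  composition with the exponential function.
\<close>

lemma elliptic_holomorphic_constant:
  assumes g: "g holomorphic_on - {0}" and per: "\<And>x. x \<noteq> 0 \<Longrightarrow> g (p * x) = g x"
  obtains A where "\<And>x. x \<noteq> 0 \<Longrightarrow> g x = A"
proof -
  define K where "K = cball (0::complex) 1 - ball 0 (norm p)"
  have K0: "K \<subseteq> - {0}"
    using p_nonzero by (auto simp: K_def)
  have "compact K"
    unfolding K_def by (intro compact_diff) auto
  moreover have "continuous_on K g"
    using g K0 holomorphic_on_imp_continuous_on continuous_on_subset by blast
  ultimately have "bounded (g ` K)"
    using compact_continuous_image compact_imp_bounded by blast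
  have "(g \<circ> exp) holomorphic_on UNIV"
    by (rule holomorphic_on_compose_gen [OF _ g]) (auto intro: holomorphic_intros)
  moreover have "range (g \<circ> exp) \<subseteq> g ` K"
  proof safe
    fix w :: complex
    obtain k :: int where k: "norm p \<le> norm (p powi k * exp w)" "norm (p powi k * exp w) \<le> 1"
      using norm_orbit_in_annulus [of "exp w"] by auto
    have "g (p powi k * exp w) = g (exp w)"
      by (rule p_orbit_induct) (use per in auto)
    moreover have "p powi k * exp w \<in> K"
      using k by (simp add: K_def)
    ultimately show "(g \<circ> exp) w \<in> g ` K"
      unfolding o_def by (metis imageI)
  qed
  ultimately have "(g \<circ> exp) constant_on UNIV"
    using \<open>bounded (g ` K)\<close> bounded_subset by (intro Liouville_theorem) blast+
  then obtain A where A: "\<And>w. g (exp w) = A"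
    by (auto simp: constant_on_def)
  have "g x = A" if "x \<noteq> 0" for x
    using A [of "Ln x"] that by simp
  then show ?thesis
    by (rule that)
qed

text \<open>
  The theta functions of degree two in question are \<open>\<lambda>x. \<theta>(x/z) \<theta>(xz/Y)\<close>: for fixed \<open>Y\<close> they all
  have the same multiplier under \<open>x \<mapsto> p x\<close> and the same symmetry under \<open>x \<mapsto> Y / x\<close>.
\<close>

lemma theta2_p_mult:
  assumes "x \<noteq> 0" "z \<noteq> 0" "Y \<noteq> 0"
  shows "theta p (p * x / z) * theta p (p * x * z / Y) = Y / x\<^sup>2 * (theta p (x / z) * theta p (x * z / Y))"
  using assms theta_p_mult [of "x / z"] theta_p_mult [of "x * z / Y"]
  by (simp add: mult.assoc power2_eq_square)

lemma theta2_reflect: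
  assumes "x \<noteq> 0" "z \<noteq> 0" "Y \<noteq> 0"
  shows "theta p (Y / x / z) * theta p (Y / x * z / Y) = Y / x\<^sup>2 * (theta p (x / z) * theta p (x * z / Y))"
  using assms theta_swap [of Y "x * z"] theta_swap [of z x]
  by (simp add: power2_eq_square)

text \<open>
  The last assumption keeps the orbits of the two zeros \<open>z\<close> and \<open>Y/z\<close> apart, so that the theta product
  has simple zeros only; \<open>f\<close> vanishes at all of them, and the quotient is a holomorphic elliptic
  function.
\<close>

lemma theta2_unique:
  assumes f: "f holomorphic_on - {0}"
    and per: "\<And>x. x \<noteq> 0 \<Longrightarrow> f (p * x) = Y / x\<^sup>2 * f x"
    and "z \<noteq> 0" "Y \<noteq> 0" "f z = 0" "f (Y / z) = 0" "theta p (z\<^sup>2 / Y) \<noteq> 0"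
  obtains A where "\<And>x. x \<noteq> 0 \<Longrightarrow> f x = A * (theta p (x / z) * theta p (x * z / Y))"
proof -
  define D where "D = (\<lambda>x. theta p (x / z) * theta p (x * z / Y))"
  have D_hol: "D holomorphic_on - {0}"
    unfolding D_def using \<open>z \<noteq> 0\<close> \<open>Y \<noteq> 0\<close> by (auto intro!: holomorphic_intros)
  have f_orbit: "f (p powi k * x) = 0" if "f x = 0" "x \<noteq> 0" for k x
    by (rule p_orbit_induct [where P = "\<lambda>x. f x = 0"]) (use that per \<open>Y \<noteq> 0\<close> in auto)
  have zeros: "f x = 0 \<and> deriv D x \<noteq> 0" if x: "x \<in> - {0}" and "D x = 0" for x
  proof -
    have D_deriv: "deriv D x = deriv (theta p) (x / z) / z * theta p (x * z / Y)
        + deriv (theta p) (x * z / Y) * (z / Y) * theta p (x / z)"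
    proof (rule DERIV_imp_deriv)
      have 1: "((\<lambda>x. theta p (x / z)) has_field_derivative deriv (theta p) (x / z) * (1 / z)) (at x)"
        using x \<open>z \<noteq> 0\<close>
        by (intro DERIV_chain2 [OF field_differentiable_derivI [OF theta_field_differentiable]])
           (auto intro!: derivative_eq_intros)
      have 2: "((\<lambda>x. theta p (x * z / Y)) has_field_derivative deriv (theta p) (x * z / Y) * (z / Y)) (at x)"
        using x \<open>z \<noteq> 0\<close> \<open>Y \<noteq> 0\<close>
        by (intro DERIV_chain2 [OF field_differentiable_derivI [OF theta_field_differentiable]])
           (auto intro!: derivative_eq_intros)
      show "(D has_field_derivative deriv (theta p) (x / z) / z * theta p (x * z / Y)
        + deriv (theta p) (x * z / Y) * (z / Y) * theta p (x / z)) (at x)"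
        using DERIV_mult [OF 1 2] by (simp add: D_def)
    qed
    have "theta p (x / z) = 0 \<or> theta p (x * z / Y) = 0"
      using \<open>D x = 0\<close> by (auto simp: D_def)
    then show ?thesis
    proof
      assume 0: "theta p (x / z) = 0"
      then obtain k :: int where "x / z = p powi k"
        using theta_eq_0D [of "x / z"] x \<open>z \<noteq> 0\<close> by auto
      then have k: "x = p powi k * z"
        using \<open>z \<noteq> 0\<close> by (simp add: field_simps)
      then have "theta p (x * z / Y) \<noteq> 0"
        using theta_orbit_eq_0_iff [of "z\<^sup>2 / Y" k] assms(3,4,7) by (simp add: power2_eq_square mult.assoc)
      moreover have "f x = 0"
        unfolding k using \<open>f z = 0\<close> \<open>z \<noteq> 0\<close> by (rule f_orbit)
      moreover have "deriv (theta p) (x / z) \<noteq> 0"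
        using 0 x \<open>z \<noteq> 0\<close> by (intro deriv_theta_nonzero) auto
      ultimately show ?thesis
        using 0 \<open>z \<noteq> 0\<close> unfolding D_deriv by simp
    next
      assume 0: "theta p (x * z / Y) = 0"
      then obtain k :: int where "x * z / Y = p powi k"
        using theta_eq_0D [of "x * z / Y"] x \<open>z \<noteq> 0\<close> \<open>Y \<noteq> 0\<close> by auto
      then have k: "x = p powi k * (Y / z)"
        using \<open>z \<noteq> 0\<close> \<open>Y \<noteq> 0\<close> by (simp add: field_simps)
      have "theta p (Y / z\<^sup>2) \<noteq> 0"
        using theta_inverse [of "z\<^sup>2 / Y"] assms(3,4,7) by simp
      moreover have "x / z = p powi k * (Y / z\<^sup>2)"
        using k by (simp add: power2_eq_square)
      ultimately have "theta p (x / z) \<noteq> 0"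
        using theta_orbit_eq_0_iff [of "Y / z\<^sup>2" k] \<open>z \<noteq> 0\<close> \<open>Y \<noteq> 0\<close> by simp
      moreover have "f x = 0"
        unfolding k using \<open>f (Y / z) = 0\<close> by (rule f_orbit) (use \<open>z \<noteq> 0\<close> \<open>Y \<noteq> 0\<close> in auto)
      moreover have "deriv (theta p) (x * z / Y) \<noteq> 0"
        using 0 x \<open>z \<noteq> 0\<close> \<open>Y \<noteq> 0\<close> by (intro deriv_theta_nonzero) auto
      ultimately show ?thesis
        using 0 \<open>z \<noteq> 0\<close> \<open>Y \<noteq> 0\<close> unfolding D_deriv by simp
    qed
  qed
  obtain g where g: "g holomorphic_on - {0}" and fg: "\<And>x. x \<in> - {0} \<Longrightarrow> f x = g x * D x"
    using holomorphic_factor_simple_zeros [OF _ f D_hol zeros] by auto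
  \<comment> \<open>The functional equations give this only where \<open>D\<close> does not vanish. If it failed at \<open>x\<close>, it would
    fail near \<open>x\<close>, and \<open>D\<close> would vanish there identically and not have simple zeros.\<close>
  have "g (p * x) = g x" if x: "x \<noteq> 0" for x
  proof (rule ccontr)
    assume "g (p * x) \<noteq> g x"
    define h where "h = (\<lambda>x. g (p * x) - g x)"
    have "(\<lambda>x. g (p * x)) holomorphic_on - {0}"
      by (rule holomorphic_on_compose_gen [OF _ g, unfolded o_def])
         (use p_nonzero in \<open>auto intro!: holomorphic_intros\<close>)
    then have "continuous_on (- {0}) h"
      unfolding h_def using g by (intro holomorphic_on_imp_continuous_on holomorphic_intros)
    then have "open (- {0} \<inter> h -` (- {0}))"
      by (intro continuous_open_preimage) auto
    moreover have D0: "D y = 0" if "y \<in> - {0} \<inter> h -` (- {0})" for y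
    proof -
      have "D (p * y) = Y / y\<^sup>2 * D y"
        using theta2_p_mult [OF _ \<open>z \<noteq> 0\<close> \<open>Y \<noteq> 0\<close>] that by (simp add: D_def)
      then have "g (p * y) * (Y / y\<^sup>2 * D y) = f (p * y)"
        using fg [of "p * y"] that p_nonzero by simp
      also have "\<dots> = Y / y\<^sup>2 * f y"
        using that by (intro per) auto
      also have "f y = g y * D y"
        using that by (intro fg) auto
      finally have "Y / y\<^sup>2 * (h y * D y) = 0"
        unfolding h_def by (simp only: algebra_simps) simp
      then show ?thesis
        using that \<open>Y \<noteq> 0\<close> by auto
    qed
    moreover have x': "x \<in> - {0} \<inter> h -` (- {0})"
      using x \<open>g (p * x) \<noteq> g x\<close> by (simp add: h_def)
    ultimately have "(D has_field_derivative 0) (at x)"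
      by (intro has_field_derivative_transform_within_open [of "\<lambda>_. 0" 0 x "- {0} \<inter> h -` (- {0})" D]) auto
    then show False
      using zeros [of x] D0 [OF x'] x by (auto dest: DERIV_imp_deriv)
  qed
  then obtain A where "\<And>x. x \<noteq> 0 \<Longrightarrow> g x = A"
    using elliptic_holomorphic_constant [OF g] by metis
  then show ?thesis
    using fg that by (auto simp: D_def)
qed

text \<open>
  The coefficient \<open>B\<close> is chosen such that the difference vanishes at \<open>x0\<close>; by the symmetry
  under \<open>x \<mapsto> Y / x\<close> it then vanishes at \<open>Y / x0\<close> as well.
\<close>

lemma theta2_span:
  assumes nz: "x0 \<noteq> 0" "x1 \<noteq> 0" "Y \<noteq> 0" "z \<noteq> 0"
    and gen: "theta p (x0 / x1) \<noteq> 0" "theta p (x0 * x1 / Y) \<noteq> 0" "theta p (x0\<^sup>2 / Y) \<noteq> 0"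
  obtains A B where "\<And>x. x \<noteq> 0 \<Longrightarrow> theta p (x / z) * theta p (x * z / Y) =
      A * (theta p (x / x0) * theta p (x * x0 / Y)) + B * (theta p (x / x1) * theta p (x * x1 / Y))"
proof -
  define D where "D = (\<lambda>z x. theta p (x / z) * theta p (x * z / Y))"
  define B where "B = D z x0 / D x1 x0"
  define f where "f = (\<lambda>x. D z x - B * D x1 x)"
  have f0: "f x0 = 0"
    using gen by (simp add: f_def B_def D_def)
  obtain A where "\<And>x. x \<noteq> 0 \<Longrightarrow> f x = A * (theta p (x / x0) * theta p (x * x0 / Y))"
  proof (rule theta2_unique [of f Y x0])
    show "f holomorphic_on - {0}"
      unfolding f_def D_def using nz by (auto intro!: holomorphic_intros)
    show "f (p * x) = Y / x\<^sup>2 * f x" if "x \<noteq> 0" for x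
    proof -
      have "D w (p * x) = Y / x\<^sup>2 * D w x" if "w \<noteq> 0" for w
        unfolding D_def using \<open>x \<noteq> 0\<close> that nz(3) by (rule theta2_p_mult)
      then show ?thesis
        using nz by (simp only: f_def right_diff_distrib mult.left_commute not_False_eq_True)
    qed
    have "D w (Y / x0) = Y / x0\<^sup>2 * D w x0" if "w \<noteq> 0" for w
      unfolding D_def using nz(1) that nz(3) by (rule theta2_reflect)
    then have "f (Y / x0) = Y / x0\<^sup>2 * f x0"
      using nz by (simp only: f_def right_diff_distrib mult.left_commute not_False_eq_True)
    then show "f (Y / x0) = 0"
      using f0 by simp
  qed (use assms f0 in auto)
  then show ?thesis
    using that [of A B] by (simp add: f_def D_def algebra_simps)
qed

end

section \<open>Elliptic partial fractions\<close>

context nome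
begin

text \<open>
  As functions of \<open>x m\<close>, the two factors with \<open>y i0\<close> and \<open>y i1\<close> lie in the span of the two products
  with zeros \<open>x i, Y / x i\<close> for \<open>i = i0\<close> and \<open>i = i1\<close>, where \<open>Y = y i0 * y i1\<close>. In each of the two resulting
  sums the term \<open>m = i\<close> vanishes, and in the others the factor with \<open>x i\<close> cancels, which leaves
  an instance on \<open>I - {i}\<close> with \<open>Y / x i\<close> in place of the two \<open>y\<close>'s.
\<close>

lemma theta_partial_fractions_generic_step:
  fixes x y :: "'a \<Rightarrow> complex"
  assumes I: "finite I" "i0 \<in> I" "i1 \<in> I" "i0 \<noteq> i1"
    and nz: "\<And>i. i \<in> I \<Longrightarrow> x i \<noteq> 0" "\<And>i. i \<in> I \<Longrightarrow> y i \<noteq> 0"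
    and dist: "\<And>i j. i \<in> I \<Longrightarrow> j \<in> I \<Longrightarrow> i \<noteq> j \<Longrightarrow> theta p (x i / x j) \<noteq> 0"
    and prod_eq: "(\<Prod>i\<in>I. x i) = (\<Prod>i\<in>I. y i)"
    and gen: "theta p (x i0 * x i1 / (y i0 * y i1)) \<noteq> 0" "theta p ((x i0)\<^sup>2 / (y i0 * y i1)) \<noteq> 0"
    and smaller: "\<And>i y'. i \<in> I \<Longrightarrow> (\<And>j. j \<in> I - {i} \<Longrightarrow> y' j \<noteq> 0) \<Longrightarrow>
      (\<Prod>j\<in>I - {i}. x j) = (\<Prod>j\<in>I - {i}. y' j) \<Longrightarrow>
      (\<Sum>m\<in>I - {i}. (\<Prod>j\<in>I - {i}. theta p (x m / y' j)) / (\<Prod>j\<in>I - {i} - {m}. theta p (x m / x j))) = 0"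
  shows "(\<Sum>m\<in>I. (\<Prod>j\<in>I. theta p (x m / y j)) / (\<Prod>j\<in>I - {m}. theta p (x m / x j))) = 0"
proof -
  define Y where "Y = y i0 * y i1"
  define R where "R = I - {i0, i1}"
  define c where "c = (\<lambda>m. (\<Prod>j\<in>R. theta p (x m / y j)) / (\<Prod>j\<in>I - {m}. theta p (x m / x j)))"
  have Y0: "Y \<noteq> 0"
    using nz I by (simp add: Y_def)
  have R: "finite R" "i0 \<notin> R" "i1 \<notin> R"
    using I by (auto simp: R_def)
  have I_eq: "I = insert i0 (insert i1 R)"
    using I by (auto simp: R_def)
  have prod_R: "(\<Prod>j\<in>R. x j) * (x i0 * x i1) = (\<Prod>j\<in>R. y j) * Y"
    using prod_eq I R by (simp add: I_eq Y_def mult_ac)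
  have vanish: "(\<Sum>m\<in>I. theta p (x m / x i) * theta p (x m * x i / Y) * c m) = 0"
    if ii: "i \<in> I" "i' \<in> I" "{i, i'} = {i0, i1}" for i i'
  proof -
    have ne: "i \<noteq> i'" and R': "I - {i} = insert i' R" "i' \<notin> R" "i \<notin> R"
      using ii I R by (auto simp: I_eq doubleton_eq_iff)
    define y' where "y' = y(i' := Y / x i)"
    have y'_R: "y' j = y j" if "j \<in> R" for j
      using that R' by (auto simp: y'_def)
    have x_ii': "x i * x i' = x i0 * x i1"
      using ii(3) by (auto simp: doubleton_eq_iff)
    have term_eq: "theta p (x m / x i) * theta p (x m * x i / Y) * c m =
        (\<Prod>j\<in>I - {i}. theta p (x m / y' j)) / (\<Prod>j\<in>I - {i} - {m}. theta p (x m / x j))"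
      if m: "m \<in> I - {i}" for m
    proof -
      have "(\<Prod>j\<in>I - {m}. theta p (x m / x j)) =
          theta p (x m / x i) * (\<Prod>j\<in>I - {m} - {i}. theta p (x m / x j))"
        using I ii m by (intro prod.remove) auto
      moreover have "I - {m} - {i} = I - {i} - {m}"
        by auto
      moreover have "(\<Prod>j\<in>I - {i}. theta p (x m / y' j)) =
          theta p (x m * x i / Y) * (\<Prod>j\<in>R. theta p (x m / y j))"
        using R R' y'_R by (simp add: y'_def)
      moreover have "theta p (x m / x i) \<noteq> 0"
        using dist ii m by auto
      ultimately show ?thesis
        by (simp add: c_def)
    qed
    have "(\<Sum>m\<in>I. theta p (x m / x i) * theta p (x m * x i / Y) * c m) =
        (\<Sum>m\<in>I - {i}. theta p (x m / x i) * theta p (x m * x i / Y) * c m)"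
      using I ii nz by (subst sum.remove [of I i]) auto
    also have "\<dots> = (\<Sum>m\<in>I - {i}. (\<Prod>j\<in>I - {i}. theta p (x m / y' j)) /
        (\<Prod>j\<in>I - {i} - {m}. theta p (x m / x j)))"
      by (intro sum.cong refl term_eq)
    also have "\<dots> = 0"
    proof (rule smaller [OF ii(1)])
      show "y' j \<noteq> 0" if "j \<in> I - {i}" for j
        using that nz ii Y0 by (auto simp: y'_def)
      have "(\<Prod>j\<in>I - {i}. y' j) * x i = Y * (\<Prod>j\<in>R. y j)"
        unfolding R'(1) using R R' y'_R nz(1) [OF ii(1)] by (simp add: y'_def)
      also have "\<dots> = (\<Prod>j\<in>I - {i}. x j) * x i"
        unfolding R'(1) using R R' prod_R by (simp add: x_ii' [symmetric] mult_ac)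
      finally show "(\<Prod>j\<in>I - {i}. x j) = (\<Prod>j\<in>I - {i}. y' j)"
        using nz(1) [OF ii(1)] by simp
    qed
    finally show ?thesis .
  qed
  obtain A B where AB: "\<And>z. z \<noteq> 0 \<Longrightarrow> theta p (z / y i0) * theta p (z * y i0 / Y) =
      A * (theta p (z / x i0) * theta p (z * x i0 / Y)) + B * (theta p (z / x i1) * theta p (z * x i1 / Y))"
    using theta2_span [of "x i0" "x i1" Y "y i0"] nz I Y0 gen dist unfolding Y_def by metis
  have "(\<Sum>m\<in>I. (\<Prod>j\<in>I. theta p (x m / y j)) / (\<Prod>j\<in>I - {m}. theta p (x m / x j))) =
      (\<Sum>m\<in>I. theta p (x m / y i0) * theta p (x m * y i0 / Y) * c m)"
  proof (intro sum.cong refl)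
    fix m assume "m \<in> I"
    have "(\<Prod>j\<in>I. theta p (x m / y j)) =
        theta p (x m / y i0) * theta p (x m / y i1) * (\<Prod>j\<in>R. theta p (x m / y j))"
      using R I by (subst I_eq) (simp add: mult.assoc)
    moreover have "x m * y i0 / Y = x m / y i1"
      using nz I by (simp add: Y_def)
    ultimately show "(\<Prod>j\<in>I. theta p (x m / y j)) / (\<Prod>j\<in>I - {m}. theta p (x m / x j)) =
        theta p (x m / y i0) * theta p (x m * y i0 / Y) * c m"
      by (simp add: c_def)
  qed
  also have "\<dots> = (\<Sum>m\<in>I. A * (theta p (x m / x i0) * theta p (x m * x i0 / Y) * c m)
      + B * (theta p (x m / x i1) * theta p (x m * x i1 / Y) * c m))"
  proof (intro sum.cong refl)
    fix m assume "m \<in> I"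
    show "theta p (x m / y i0) * theta p (x m * y i0 / Y) * c m =
      A * (theta p (x m / x i0) * theta p (x m * x i0 / Y) * c m)
      + B * (theta p (x m / x i1) * theta p (x m * x i1 / Y) * c m)"
      unfolding AB [OF nz(1) [OF \<open>m \<in> I\<close>]] by (simp only: distrib_right mult.assoc)
  qed
  also have "\<dots> = 0"
    using vanish [of i0 i1] vanish [of i1 i0] I
    by (simp add: sum.distrib insert_commute flip: sum_distrib_left)
  finally show ?thesis .
qed

text \<open>
  One point is trivial since \<open>\<theta>(1) = 0\<close>, two points are the reflection formula. With at least
  three points, a third index leaves room to move \<open>y i0 * y i1\<close> without changing the product of
  all \<open>y\<close>'s.
\<close>

proposition theta_partial_fractions:
  fixes x y :: "'a \<Rightarrow> complex"
  assumes "finite I" "\<And>i. i \<in> I \<Longrightarrow> x i \<noteq> 0" "\<And>i. i \<in> I \<Longrightarrow> y i \<noteq> 0"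
    and "\<And>i j. i \<in> I \<Longrightarrow> j \<in> I \<Longrightarrow> i \<noteq> j \<Longrightarrow> theta p (x i / x j) \<noteq> 0"
    and "(\<Prod>i\<in>I. x i) = (\<Prod>i\<in>I. y i)"
  shows "(\<Sum>m\<in>I. (\<Prod>j\<in>I. theta p (x m / y j)) / (\<Prod>j\<in>I - {m}. theta p (x m / x j))) = 0"
  using assms
proof (induction "card I" arbitrary: I y rule: less_induct)
  case less
  note fin = less.prems(1) and nzx = less.prems(2) and nzy = less.prems(3)
    and dist = less.prems(4) and prod_eq = less.prems(5)
  consider "card I = 0" | "card I = 1" | "card I = 2" | "card I \<ge> 3"
    by linarith
  then show ?case
  proof cases
    case 1
    then show ?thesis
      using fin by simp
  next
    case 2
    then obtain i where "I = {i}"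
      by (auto simp: card_1_singleton_iff)
    then show ?thesis
      using prod_eq nzy by simp
  next
    case 3
    then obtain i j where I: "I = {i, j}" "i \<noteq> j"
      by (auto simp: card_2_iff)
    have nz: "x i \<noteq> 0" "x j \<noteq> 0" "y i \<noteq> 0" "y j \<noteq> 0"
      using nzx nzy I by auto
    have th: "theta p (x i / x j) \<noteq> 0"
      using dist I by auto
    have P: "x i * x j = y i * y j"
      using prod_eq I by simp
    have diff: "I - {i} = {j}" "I - {j} = {i}"
      using I by auto
    have 1: "x j / y i = y j / x i" "x j / y j = y i / x i"
      using P nz by (auto simp: field_simps)
    have "theta p (x j / y i) = - (y j / x i) * theta p (x i / y j)"
      "theta p (x j / y j) = - (y i / x i) * theta p (x i / y i)"
      "theta p (x j / x i) = - (x j / x i) * theta p (x i / x j)"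
      unfolding 1 using nz by (intro theta_swap; simp)+
    moreover have "(- (y j / x i)) * (- (y i / x i)) / (- (x j / x i)) = - 1"
      using P nz by (simp add: field_simps)
    moreover have "(a * u) * (b * v) / (c * w) = a * b / c * (v * u / w)" for a b c u v w :: complex
      by (simp only: times_divide_times_eq mult_ac)
    ultimately have "theta p (x j / y i) * theta p (x j / y j) / theta p (x j / x i) =
        - 1 * (theta p (x i / y i) * theta p (x i / y j) / theta p (x i / x j))"
      by metis
    then show ?thesis
      using I(2) unfolding diff by (simp add: I(1) diff [unfolded I(1)] mult_ac)
  next
    case 4
    obtain i0 i1 i2 where i: "i0 \<in> I" "i1 \<in> I" "i2 \<in> I" "i0 \<noteq> i1" "i0 \<noteq> i2" "i1 \<noteq> i2"
    proof -
      obtain T where "T \<subseteq> I" "card T = 3"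
        using obtain_subset_with_card_n [OF 4] by blast
      then show ?thesis
        using that by (auto simp: card_3_iff)
    qed
    \<comment> \<open>Rescaling two of the \<open>y\<close>'s in opposite directions keeps their product and moves
      \<open>y i0 * y i1\<close> away from the exceptional values.\<close>
    define Y where "Y = (\<lambda>t::real. y(i0 := y i0 * of_real (exp t), i2 := y i2 * of_real (exp (- t))))"
    define F where "F = (\<lambda>t. \<Sum>m\<in>I. (\<Prod>j\<in>I. theta p (x m / Y t j)) / (\<Prod>j\<in>I - {m}. theta p (x m / x j)))"
    define bad where "bad = (\<lambda>c. {t::real. theta p (c / (y i0 * y i1) * of_real (exp (- 1 * t))) = 0})"
    have Y0: "Y 0 = y"
      by (simp add: Y_def)
    have "F 0 = 0"
    proof (rule eq_at_0_if_eq_off_countable [where f = F and g = "\<lambda>_. 0"])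
      show "countable (bad (x i0 * x i1) \<union> bad ((x i0)\<^sup>2))"
        unfolding bad_def using nzx nzy i
        by (intro countable_Un countable_theta_exp_zeros) auto
    next
      fix t assume t: "t \<notin> bad (x i0 * x i1) \<union> bad ((x i0)\<^sup>2)"
      have Y01: "c / (Y t i0 * Y t i1) = c / (y i0 * y i1) * of_real (exp (- 1 * t))" for c
        using i by (simp add: Y_def exp_minus field_simps)
      have prod_Y: "(\<Prod>j\<in>I. Y t j) = (\<Prod>j\<in>I. y j)"
      proof -
        have "(\<Prod>j\<in>I. f j) = f i0 * f i2 * (\<Prod>j\<in>I - {i0} - {i2}. f j)" for f :: "'a \<Rightarrow> complex"
          using fin i by (simp add: prod.remove [of I i0] prod.remove [of "I - {i0}" i2] mult.assoc)
        moreover have "(\<Prod>j\<in>I - {i0} - {i2}. Y t j) = (\<Prod>j\<in>I - {i0} - {i2}. y j)"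
          by (intro prod.cong) (auto simp: Y_def)
        moreover have "Y t i0 * Y t i2 = y i0 * y i2"
          using i by (simp add: Y_def exp_minus)
        ultimately show ?thesis
          by metis
      qed
      show "F t = 0"
        unfolding F_def
      proof (rule theta_partial_fractions_generic_step [OF fin i(1,2,4)])
        show "theta p (x i0 * x i1 / (Y t i0 * Y t i1)) \<noteq> 0"
          "theta p ((x i0)\<^sup>2 / (Y t i0 * Y t i1)) \<noteq> 0"
          using t unfolding Y01 by (auto simp: bad_def)
        show "Y t j \<noteq> 0" if "j \<in> I" for j
          using nzy that i by (auto simp: Y_def)
        show "(\<Prod>j\<in>I. x j) = (\<Prod>j\<in>I. Y t j)"
          using prod_eq prod_Y by simp
      next
        fix k y'
        assume k: "k \<in> I" and y': "\<And>j. j \<in> I - {k} \<Longrightarrow> y' j \<noteq> 0"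
          "(\<Prod>j\<in>I - {k}. x j) = (\<Prod>j\<in>I - {k}. y' j)"
        show "(\<Sum>m\<in>I - {k}. (\<Prod>j\<in>I - {k}. theta p (x m / y' j)) /
            (\<Prod>j\<in>I - {k} - {m}. theta p (x m / x j))) = 0"
        proof (rule less.hyps)
          show "card (I - {k}) < card I"
            by (rule card_Diff1_less [OF fin k])
          show "finite (I - {k})"
            using fin by simp
          show "x j \<noteq> 0" if "j \<in> I - {k}" for j
            using nzx that by simp
          show "theta p (x j / x l) \<noteq> 0" if "j \<in> I - {k}" "l \<in> I - {k}" "j \<noteq> l" for j l
            using dist that by simp
        qed (fact y')+
      qed (fact nzx dist)+
    next
      have Y_lim: "((\<lambda>t. Y t j) \<longlongrightarrow> Y 0 j) (at 0)" for j
      proof -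
        have s: "Y t j = y j * of_real (exp ((if j = i0 then 1 else if j = i2 then - 1 else 0) * t))" for t
          using i by (simp add: Y_def)
        show ?thesis
          unfolding s
          by (intro tendsto_mult tendsto_const tendsto_of_real tendsto_exp tendsto_ident_at)
      qed
      show "(F \<longlongrightarrow> F 0) (at 0)"
        unfolding F_def
      proof (intro tendsto_sum tendsto_divide tendsto_prod tendsto_theta tendsto_const Y_lim)
        fix m j
        assume "m \<in> I" "j \<in> I"
        then show "Y 0 j \<noteq> 0" "x m / Y 0 j \<noteq> 0"
          using nzx nzy by (auto simp: Y0)
      next
        fix m assume "m \<in> I"
        then show "(\<Prod>j\<in>I - {m}. theta p (x m / x j)) \<noteq> 0"
          using dist fin by auto
      qed (use nzx in auto)
    qed (rule tendsto_const)
    then show ?thesis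
      by (simp add: F_def Y0)
  qed
qed

text \<open>
  The expansion for the points \<open>x\<close> together with \<open>1/c\<close> and the points \<open>y\<close> together with
  \<open>1/(cZ)\<close>; the right-hand side is minus the term of the extra point \<open>1/c\<close>.
\<close>

lemma theta_partial_fractions_extra_pole:
  fixes x y :: "'a \<Rightarrow> complex"
  assumes I: "finite I" and nz: "\<And>i. i \<in> I \<Longrightarrow> x i \<noteq> 0" "\<And>i. i \<in> I \<Longrightarrow> y i \<noteq> 0"
    and dist: "\<And>i j. i \<in> I \<Longrightarrow> j \<in> I \<Longrightarrow> i \<noteq> j \<Longrightarrow> theta p (x i / x j) \<noteq> 0"
    and c: "c \<noteq> 0" "\<And>i. i \<in> I \<Longrightarrow> theta p (x i * c) \<noteq> 0"
    and Z: "Z \<noteq> 0" "(\<Prod>i\<in>I. y i) = Z * (\<Prod>i\<in>I. x i)"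
  shows "(\<Sum>m\<in>I. (\<Prod>j\<in>I. theta p (x m / y j)) / (\<Prod>j\<in>I - {m}. theta p (x m / x j))
            * (theta p (x m * c * Z) / theta p (x m * c)))
         = theta p (1 / Z) * (\<Prod>i\<in>I. theta p (y i * c) / theta p (x i * c))"
proof -
  define X where "X = case_option (1 / c) x"
  define U where "U = case_option (1 / (c * Z)) y"
  define J where "J = insert None (Some ` I)"
  have X: "X None = 1 / c" "X (Some i) = x i" and U: "U None = 1 / (c * Z)" "U (Some i) = y i" for i
    by (simp_all add: X_def U_def)
  have prod_J: "(\<Prod>j\<in>J. f j) = f None * (\<Prod>j\<in>I. f (Some j))" for f :: "'a option \<Rightarrow> complex"
    using I by (simp add: J_def prod.reindex)
  have prod_J_None: "(\<Prod>j\<in>J - {None}. f j) = (\<Prod>j\<in>I. f (Some j))" for f :: "'a option \<Rightarrow> complex"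
    using I by (simp add: J_def prod.reindex)
  have prod_J_Some: "(\<Prod>j\<in>J - {Some m}. f j) = f None * (\<Prod>j\<in>I - {m}. f (Some j))"
    for f :: "'a option \<Rightarrow> complex" and m
  proof -
    have "J - {Some m} = insert None (Some ` (I - {m}))"
      by (auto simp: J_def)
    then show ?thesis
      using I by (simp add: prod.reindex)
  qed
  have sum_J: "(\<Sum>j\<in>J. f j) = f None + (\<Sum>j\<in>I. f (Some j))" for f :: "'a option \<Rightarrow> complex"
    using I by (simp add: J_def sum.reindex)
  have inv: "theta p (1 / (c * z)) = - (1 / (z * c)) * theta p (z * c)" if "z \<noteq> 0" for z
    using theta_inverse [of "z * c"] that c(1) by (simp add: mult.commute)
  have "(\<Sum>m\<in>J. (\<Prod>j\<in>J. theta p (X m / U j)) / (\<Prod>j\<in>J - {m}. theta p (X m / X j))) = 0"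
  proof (rule theta_partial_fractions)
    show "finite J"
      using I by (simp add: J_def)
    show "X i \<noteq> 0" "U i \<noteq> 0" if "i \<in> J" for i
      using that nz c(1) Z(1) by (auto simp: J_def X U)
    show "theta p (X i / X j) \<noteq> 0" if ij: "i \<in> J" "j \<in> J" "i \<noteq> j" for i j
    proof -
      consider k where "i = None" "j = Some k" "k \<in> I" | k where "i = Some k" "j = None" "k \<in> I"
        | k l where "i = Some k" "j = Some l" "k \<in> I" "l \<in> I" "k \<noteq> l"
        using ij by (auto simp: J_def)
      then show ?thesis
        by cases (use c nz dist in \<open>simp_all add: X inv\<close>)
    qed
    show "(\<Prod>i\<in>J. X i) = (\<Prod>i\<in>J. U i)"
      using Z c(1) by (simp add: prod_J X U)
  qed
  then have "theta p Z * ((\<Prod>j\<in>I. theta p (1 / (c * y j))) / (\<Prod>j\<in>I. theta p (1 / (c * x j))))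
     + (\<Sum>m\<in>I. (\<Prod>j\<in>I. theta p (x m / y j)) / (\<Prod>j\<in>I - {m}. theta p (x m / x j))
            * (theta p (x m * c * Z) / theta p (x m * c))) = 0"
    using c(1) by (simp add: sum_J prod_J prod_J_None prod_J_Some X U mult_ac)
  moreover have "(\<Prod>j\<in>I. theta p (1 / (c * y j))) / (\<Prod>j\<in>I. theta p (1 / (c * x j)))
      = 1 / Z * (\<Prod>i\<in>I. theta p (y i * c) / theta p (x i * c))"
  proof -
    have "(\<Prod>j\<in>I. theta p (1 / (c * y j))) / (\<Prod>j\<in>I. theta p (1 / (c * x j)))
        = (\<Prod>j\<in>I. x j / y j * (theta p (y j * c) / theta p (x j * c)))"
      unfolding prod_dividef [symmetric] using nz c(1) by (intro prod.cong refl) (simp add: inv)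
    also have "\<dots> = (\<Prod>j\<in>I. x j) / (\<Prod>j\<in>I. y j) * (\<Prod>i\<in>I. theta p (y i * c) / theta p (x i * c))"
      by (simp only: prod.distrib prod_dividef)
    also have "(\<Prod>j\<in>I. x j) / (\<Prod>j\<in>I. y j) = 1 / Z"
      using Z nz I by simp
    finally show ?thesis .
  qed
  moreover have "theta p (1 / Z) = - theta p Z / Z"
    by (rule theta_inverse [OF Z(1)])
  ultimately show ?thesis
    by (simp only: add_eq_0_iff) simp
qed

end

section \<open>The transition weights and their sum\<close>

locale nome_base = nome +
  fixes q :: complex
  assumes q_nonzero: "q \<noteq> 0"
begin

text \<open>
  All arguments below have the form \<open>A q\<^sup>s\<close> with an integer \<open>s\<close>. Keeping \<open>A\<close> and \<open>s\<close> apart turns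
  the simplification of theta quotients into integer arithmetic. The factorials \<open>(q;q,p)\<^sub>l\<close> are
  \<open>ep 1 1 l\<close>.
\<close>

definition th :: "complex \<Rightarrow> int \<Rightarrow> complex" where
  "th A s = theta p (A * q powi s)"

definition ep :: "complex \<Rightarrow> int \<Rightarrow> nat \<Rightarrow> complex" where
  "ep A s l = epoch (A * q powi s) q p l"

lemma ep_prod: "ep A s l = (\<Prod>i<l. th A (s + int i))"
  using q_nonzero by (simp add: ep_def epoch_def th_def power_int_add mult.assoc)

lemma epoch_q: "epoch q q p l = ep 1 1 l"
  by (simp add: ep_def)

lemma ep_0 [simp]: "ep A s 0 = 1"
  by (simp add: ep_prod)

lemma ep_Suc: "ep A s (Suc l) = ep A s l * th A (s + int l)"
  by (simp add: ep_prod)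

lemma ep_Suc_left: "ep A s (Suc l) = th A s * ep A (s + 1) l"
  by (simp add: ep_prod prod.lessThan_Suc_shift add_ac del: prod.lessThan_Suc)

lemma ep_shift: "ep A (s + 1) l * th A s = ep A s l * th A (s + int l)"
  using ep_Suc [of A s l] ep_Suc_left [of A s l] by (simp add: mult.commute)

lemma ep_nonzero: "(\<And>i. i < l \<Longrightarrow> th A (s + int i) \<noteq> 0) \<Longrightarrow> ep A s l \<noteq> 0"
  by (simp add: ep_prod)

definition generic :: "nat \<Rightarrow> (nat \<Rightarrow> complex) \<Rightarrow> bool" where
  "generic r a \<longleftrightarrow> (\<forall>i\<in>{1..r}. a i \<noteq> 0 \<and> (\<forall>s. th (a i) s \<noteq> 0)) \<and>
     (\<forall>i\<in>{1..r}. \<forall>j\<in>{1..r}. i \<noteq> j \<longrightarrow> (\<forall>s. th (a i / a j) s \<noteq> 0))"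

text \<open>
  The summand for \<open>k\<close> divided by the multinomial coefficient of \<open>n\<close>. The product runs over all
  ordered pairs, so that changing one \<open>n m\<close> affects only one row of it; the diagonal factors
  \<open>i = j\<close> carry the elliptic binomial coefficients of \<open>n i\<close> over \<open>k i\<close>, up to a power of \<open>q\<close>.
\<close>

definition transition :: "nat \<Rightarrow> (nat \<Rightarrow> complex) \<Rightarrow> (nat \<Rightarrow> nat) \<Rightarrow> (nat \<Rightarrow> nat) \<Rightarrow> complex" where
  "transition r a k n = (let M = \<Sum>i=1..r. k i; N = \<Sum>i=1..r. n i in
     q ^ (M * (N - M)) * (ep 1 1 M * ep 1 1 (N - M) / ep 1 1 N)
     * (\<Prod>i=1..r. ep (a i) (1 + int M - int (k i)) (k i)
          * ep (a i) (1 + int N + int M - int (n i)) (n i - k i)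
          / ep (a i) (1 + int N - int (n i)) (n i))
     * (\<Prod>i=1..r. \<Prod>j=1..r. ep (a i / a j) (- int (n i)) (n i - k i)
          / ep (a i / a j) (int (k j) - int (n i)) (n i - k i)))"

text \<open>
  With \<open>e\<^sub>m\<close> the unit vector, this is the ratio
  \<open>transition k (n - e\<^sub>m) * transition (n - e\<^sub>m) n / transition k n\<close>. It depends on \<open>k\<close> only through
  the shifted data \<open>n - k\<close>, \<open>a\<^sub>i q\<^bsup>2M - k\<^sub>i\<^esup>\<close>; for \<open>k = 0\<close> it is \<open>transition (n - e\<^sub>m) n\<close>.
\<close>

definition first_step :: "nat \<Rightarrow> (nat \<Rightarrow> complex) \<Rightarrow> (nat \<Rightarrow> nat) \<Rightarrow> (nat \<Rightarrow> nat) \<Rightarrow> nat \<Rightarrow> complex" where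
  "first_step r a k n m = (let M = \<Sum>i=1..r. k i; N = \<Sum>i=1..r. n i in
     - (q powi (int N - int M)) / th 1 (int N - int M)
     * (\<Prod>j=1..r. th (a m / a j) (int (k j) - int (n m)))
     / (\<Prod>j\<in>{1..r} - {m}. th (a m / a j) (int (n j) - int (n m)))
     * th (a m) (2 * int N - int (n m))
     * (\<Prod>i\<in>{1..r} - {m}. th (a i) (int N + int M - int (n i)))
     / (\<Prod>i=1..r. th (a i) (int N + int M - int (k i))))"

lemma first_step_eq_0: "m \<in> {1..r} \<Longrightarrow> a m \<noteq> 0 \<Longrightarrow> k m = n m \<Longrightarrow> first_step r a k n m = 0"
  by (auto simp: first_step_def Let_def th_def intro!: prod_zero bexI [of _ m])

text \<open>
  Partial fractions at the points \<open>x\<^sub>i = a\<^sub>i q\<^bsup>-n\<^sub>i\<^esup>\<close>, \<open>y\<^sub>i = a\<^sub>i q\<^bsup>-k\<^sub>i\<^esup>\<close>, with the extra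
  points \<open>q\<^bsup>-N-M\<^esup>\<close> and \<open>q\<^bsup>-2N\<^esup>\<close>.
\<close>

lemma sum_first_step:
  assumes gen: "generic r a" and sums: "(\<Sum>i=1..r. k i) = M" "(\<Sum>i=1..r. n i) = N"
    and NM: "th 1 (int N - int M) \<noteq> 0"
  shows "(\<Sum>m=1..r. first_step r a k n m) = 1"
proof -
  define I where "I = {1..r}"
  define x where "x = (\<lambda>i. a i * q powi (- int (n i)))"
  define y where "y = (\<lambda>i. a i * q powi (- int (k i)))"
  define c where "c = q powi (int N + int M)"
  define Z where "Z = q powi (int N - int M)"
  have nz: "a i \<noteq> 0" "x i \<noteq> 0" "y i \<noteq> 0" if "i \<in> I" for i
    using gen that q_nonzero by (auto simp: generic_def x_def y_def I_def)
  have xy: "theta p (x m / y j) = th (a m / a j) (int (k j) - int (n m))" for m j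
    using q_nonzero by (simp add: x_def y_def th_def power_int_diff power_int_minus field_simps)
  have xx: "theta p (x m / x j) = th (a m / a j) (int (n j) - int (n m))" for m j
    using q_nonzero by (simp add: x_def th_def power_int_diff power_int_minus field_simps)
  have xc: "theta p (x i * c) = th (a i) (int N + int M - int (n i))" for i
    using q_nonzero by (simp add: x_def c_def th_def power_int_diff power_int_minus field_simps)
  have yc: "theta p (y i * c) = th (a i) (int N + int M - int (k i))" for i
    using q_nonzero by (simp add: y_def c_def th_def power_int_diff power_int_minus field_simps)
  have cZ: "c * Z = q powi (2 * int N)"
    using q_nonzero by (simp add: c_def Z_def flip: power_int_add)
  have xcZ: "theta p (x i * c * Z) = th (a i) (2 * int N - int (n i))" for i
    using q_nonzero
    by (simp add: mult.assoc cZ) (simp add: x_def th_def power_int_diff power_int_minus field_simps)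
  have prod_powi: "(\<Prod>i\<in>I. q powi (- int (f i))) = q powi (- int (\<Sum>i\<in>I. f i))" for f
    using q_nonzero
    by (induction I rule: infinite_finite_induct) (simp_all add: power_int_diff power_int_minus field_simps)
  have pf: "(\<Sum>m\<in>I. (\<Prod>j\<in>I. theta p (x m / y j)) / (\<Prod>j\<in>I - {m}. theta p (x m / x j))
            * (theta p (x m * c * Z) / theta p (x m * c)))
         = theta p (1 / Z) * (\<Prod>i\<in>I. theta p (y i * c) / theta p (x i * c))"
  proof (rule theta_partial_fractions_extra_pole)
    show "theta p (x i / x j) \<noteq> 0" if "i \<in> I" "j \<in> I" "i \<noteq> j" for i j
      using gen that unfolding xx by (auto simp: generic_def I_def)
    show "theta p (x i * c) \<noteq> 0" if "i \<in> I" for i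
      using gen that unfolding xc by (auto simp: generic_def I_def)
    show "(\<Prod>i\<in>I. y i) = Z * (\<Prod>i\<in>I. x i)"
      unfolding x_def y_def prod.distrib prod_powi using sums q_nonzero
      by (simp add: I_def Z_def power_int_diff power_int_minus field_simps)
  qed (use nz q_nonzero in \<open>auto simp: I_def c_def Z_def\<close>)
  define C where "C = - Z / th 1 (int N - int M) * (\<Prod>i\<in>I. theta p (x i * c) / theta p (y i * c))"
  have "(\<Sum>m=1..r. first_step r a k n m) =
      (\<Sum>m\<in>I. C * ((\<Prod>j\<in>I. theta p (x m / y j)) / (\<Prod>j\<in>I - {m}. theta p (x m / x j))
            * (theta p (x m * c * Z) / theta p (x m * c))))"
  proof (unfold I_def [symmetric], intro sum.cong refl)
    fix m assume m: "m \<in> I"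
    have "theta p (x m * c) \<noteq> 0"
      using gen m unfolding xc by (auto simp: generic_def I_def)
    moreover have "(\<Prod>i\<in>I. theta p (x i * c)) = theta p (x m * c) * (\<Prod>i\<in>I - {m}. theta p (x i * c))"
      using m by (intro prod.remove) (auto simp: I_def)
    ultimately show "first_step r a k n m = C * ((\<Prod>j\<in>I. theta p (x m / y j)) /
        (\<Prod>j\<in>I - {m}. theta p (x m / x j)) * (theta p (x m * c * Z) / theta p (x m * c)))"
      unfolding first_step_def Let_def I_def [symmetric] sums [folded I_def] C_def prod_dividef
      by (simp add: xy xx xc yc xcZ Z_def [symmetric]) (simp only: mult_ac)
  qed
  also have "\<dots> = C * (theta p (1 / Z) * (\<Prod>i\<in>I. theta p (y i * c) / theta p (x i * c)))"
    unfolding sum_distrib_left [symmetric] pf ..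
  also have "\<dots> = 1"
  proof -
    have "(\<Prod>i\<in>I. theta p (x i * c)) \<noteq> 0" "(\<Prod>i\<in>I. theta p (y i * c)) \<noteq> 0"
      using gen unfolding xc yc by (auto simp: generic_def I_def)
    moreover have "Z \<noteq> 0" "theta p Z = th 1 (int N - int M)"
      using q_nonzero by (auto simp: Z_def th_def)
    ultimately show ?thesis
      using NM theta_inverse [of Z] by (simp add: C_def prod_dividef)
  qed
  finally show ?thesis .
qed

text \<open>
  Lowering \<open>n m\<close> by one removes one theta factor from each shifted factorial in row \<open>m\<close> and shifts the
  others by one step; both sides reduce to the same product.
\<close>

lemma transition_first_step:
  assumes gen: "generic r a" and sums: "(\<Sum>i=1..r. k i) = M" "(\<Sum>i=1..r. n i) = N"
    and qs: "\<And>s. 1 \<le> s \<Longrightarrow> s \<le> N \<Longrightarrow> th 1 (int s) \<noteq> 0"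
    and le: "\<And>i. i \<in> {1..r} \<Longrightarrow> k i \<le> n i" and m: "m \<in> {1..r}" "k m < n m"
  shows "transition r a k n * first_step r a k n m =
    transition r a k (n(m := n m - 1)) * first_step r a (\<lambda>_. 0) n m"
proof -
  define I where "I = {1..r}"
  have fin: "finite I" and mI: "m \<in> I"
    using m by (auto simp: I_def)
  obtain u where u: "n m = Suc u" "k m \<le> u"
    using m by (cases "n m") auto
  define n' where "n' = n(m := n m - 1)"
  have n'm: "n' m = u" and n'i: "i \<noteq> m \<Longrightarrow> n' i = n i" for i
    by (auto simp: n'_def u)
  have M_le: "M \<le> sum n' I"
    unfolding sums(1) [symmetric] I_def [symmetric] using le u n'i n'm
    by (intro sum_mono) (metis I_def)
  define N' where "N' = sum n' I"
  have N: "N = Suc N'"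
  proof -
    have "sum n I = n m + sum n (I - {m})" "sum n' I = n' m + sum n' (I - {m})"
      using fin mI by (auto intro: sum.remove)
    moreover have "sum n' (I - {m}) = sum n (I - {m})"
      by (intro sum.cong) (auto simp: n'i)
    ultimately show ?thesis
      using sums by (simp add: N'_def n'm u I_def)
  qed
  have M_N': "M \<le> N'"
    using M_le by (simp add: N'_def)
  have sums': "sum k I = M" "sum n I = N" "sum n' I = N'"
    using sums by (auto simp: I_def N'_def)
  have th_a: "th (a i) s \<noteq> 0" "a i \<noteq> 0" if "i \<in> I" for i s
    using gen that by (auto simp: generic_def I_def)
  have th_aa: "th (a i / a j) s \<noteq> 0" if "i \<in> I" "j \<in> I" "i \<noteq> j" for i j s
    using gen that by (auto simp: generic_def I_def)
  have n_le: "n i \<le> N" if "i \<in> I" for i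
    using that fin sums by (metis I_def member_le_sum zero_le)
  have th_neg: "th 1 (- int s) \<noteq> 0" if "1 \<le> s" "s \<le> N" for s
    using theta_inverse [of "q powi int s"] qs [OF that] q_nonzero
    by (simp add: th_def power_int_minus inverse_eq_divide)
  have th_mj: "th (a m / a j) (- int (n m)) \<noteq> 0" "th (a m / a j) (int (k j) - int (n m)) \<noteq> 0"
    if "j \<in> I" for j
  proof -
    have "th 1 (- int (n m)) \<noteq> 0"
      using n_le [OF mI] u by (intro th_neg) auto
    moreover have "th 1 (- int (n m - k m)) \<noteq> 0"
      using n_le [OF mI] u by (intro th_neg) auto
    ultimately show "th (a m / a j) (- int (n m)) \<noteq> 0" "th (a m / a j) (int (k j) - int (n m)) \<noteq> 0"
      using th_aa [OF mI that] th_a(2) [OF that] u by (cases "j = m"; auto simp: algebra_simps)+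
  qed

  \<comment> \<open>Together with \<open>W\<close>, the three parts of \<open>transition\<close>.\<close>
  define S where "S = (\<lambda>N n i. ep (a i) (1 + int M - int (k i)) (k i)
          * ep (a i) (1 + int N + int M - int (n i :: nat)) (n i - k i)
          / ep (a i) (1 + int N - int (n i)) (n i))"
  define T where "T = (\<lambda>n i. \<Prod>j\<in>I. ep (a i / a j) (- int (n i :: nat)) (n i - k i)
          / ep (a i / a j) (int (k j) - int (n i)) (n i - k i))"
  define X where "X = (\<lambda>i. if i = m then 1 else th (a i) (int N - int (n i)) / th (a i) (int N + int M - int (n i)))"
  have S_m: "S N n m = S N' n' m * (th (a m) (int N + int M - int (k m)) / th (a m) (int N))"
  proof -
    have "n m - k m = Suc (u - k m)"
      using u by simp
    moreover have "1 + int N + int M - int (n m) + int (u - k m) = int N + int M - int (k m)"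
      using u by simp
    moreover have "1 + int N - int (n m) + int u = int N"
      using u by simp
    ultimately show ?thesis
      using u by (simp add: S_def n'm N ep_Suc algebra_simps)
  qed
  have S_i: "S N n i = S N' n' i * (th (a i) (int N + int M - int (k i)) / th (a i) (int N)) * X i"
    if i: "i \<in> I" for i
  proof (cases "i = m")
    case True
    then show ?thesis
      using S_m by (simp add: X_def)
  next
    case False
    have "ep (a i) (int N + int M - int (n i) + 1) (n i - k i) * th (a i) (int N + int M - int (n i))
       = ep (a i) (int N + int M - int (n i)) (n i - k i) * th (a i) (int N + int M - int (k i))"
      using ep_shift [of "a i" "int N + int M - int (n i)" "n i - k i"] le i
      by (simp add: I_def add_diff_eq)
    then have 1: "ep (a i) (1 + int N + int M - int (n i)) (n i - k i)
       = ep (a i) (int N + int M - int (n i)) (n i - k i) * th (a i) (int N + int M - int (k i)) / th (a i) (int N + int M - int (n i))"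
      using th_a [OF i] by (simp add: field_simps)
    have "ep (a i) (int N - int (n i) + 1) (n i) * th (a i) (int N - int (n i))
       = ep (a i) (int N - int (n i)) (n i) * th (a i) (int N)"
      using ep_shift [of "a i" "int N - int (n i)" "n i"] by simp
    then have 2: "ep (a i) (1 + int N - int (n i)) (n i)
       = ep (a i) (int N - int (n i)) (n i) * th (a i) (int N) / th (a i) (int N - int (n i))"
      using th_a [OF i] by (simp add: field_simps)
    have N1: "1 + int N' = int N"
      using N by simp
    show ?thesis
      using False th_a [OF i] by (simp add: S_def X_def n'i N1 1 2 mult_ac)
  qed
  have T_m: "T n m = T n' m * (\<Prod>j\<in>I. th (a m / a j) (- int (n m)) / th (a m / a j) (int (k j) - int (n m)))"
  proof -
    have l: "n m - k m = Suc (u - k m)"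
      using u by simp
    have s: "- int (n m) + 1 = - int u" "int (k j) - int (n m) + 1 = int (k j) - int u" for j
      using u by auto
    show ?thesis
      unfolding T_def prod.distrib [symmetric] n'm l ep_Suc_left s by (simp add: mult.commute)
  qed
  have T_i: "T n i = T n' i" if "i \<noteq> m" for i
    using that by (simp add: T_def n'i)
  have prod_T: "(\<Prod>i\<in>I. T n i) = (\<Prod>i\<in>I. T n' i)
      * ((\<Prod>j\<in>I. th (a m / a j) (- int (n m))) / (\<Prod>j\<in>I. th (a m / a j) (int (k j) - int (n m))))"
  proof -
    have "(\<Prod>i\<in>I - {m}. T n i) = (\<Prod>i\<in>I - {m}. T n' i)"
      by (intro prod.cong) (auto simp: T_i)
    then show ?thesis
      using fin mI by (simp add: prod.remove [of I m] T_m prod_dividef)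
  qed
  have prod_S: "(\<Prod>i\<in>I. S N n i) = (\<Prod>i\<in>I. S N' n' i)
      * ((\<Prod>i\<in>I. th (a i) (int N + int M - int (k i))) / (\<Prod>i\<in>I. th (a i) (int N)))
      * ((\<Prod>i\<in>I - {m}. th (a i) (int N - int (n i))) / (\<Prod>i\<in>I - {m}. th (a i) (int N + int M - int (n i))))"
  proof -
    have "(\<Prod>i\<in>I. X i) = (\<Prod>i\<in>I - {m}. th (a i) (int N - int (n i)) / th (a i) (int N + int M - int (n i)))"
      using fin mI by (simp add: prod.remove [of I m] X_def)
    then show ?thesis
      by (simp add: S_i prod.distrib prod_dividef)
  qed
  define W where "W = (\<lambda>N. q ^ (M * (N - M)) * (ep 1 1 M * ep 1 1 (N - M) / ep 1 1 N))"
  have W_N: "W N = W N' * (q ^ M * th 1 (int N - int M) / th 1 (int N))"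
    using M_N' by (simp add: W_def N Suc_diff_le ep_Suc power_add add_ac add_diff_eq)
  have th_NM: "th 1 (int N - int M) \<noteq> 0"
    using qs [of "N - M"] M_N' by (simp add: N of_nat_diff)
  have tr: "transition r a k n = W N * (\<Prod>i\<in>I. S N n i) * (\<Prod>i\<in>I. T n i)"
    "transition r a k n' = W N' * (\<Prod>i\<in>I. S N' n' i) * (\<Prod>i\<in>I. T n' i)"
    unfolding transition_def Let_def I_def [symmetric] sums' W_def S_def T_def by (rule refl)+
  have q_pow: "q ^ N = q ^ M * q powi (int N - int M)"
    using q_nonzero by (simp add: power_int_diff)
  have nonzero: "(\<Prod>i\<in>I. th (a i) (int N)) \<noteq> 0"
    "(\<Prod>i\<in>I. th (a i) (int N + int M - int (k i))) \<noteq> 0"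
    "(\<Prod>i\<in>I - {m}. th (a i) (int N + int M - int (n i))) \<noteq> 0"
    "(\<Prod>j\<in>I. th (a m / a j) (int (k j) - int (n m))) \<noteq> 0"
    using fin th_a th_mj by (auto simp: prod_zero_iff)
  have "transition r a k n * first_step r a k n m = transition r a k n' * first_step r a (\<lambda>_. 0) n m"
    unfolding tr first_step_def Let_def I_def [symmetric] sums' prod_T prod_S W_N
    using nonzero th_NM by (simp add: q_pow mult_ac)
  then show ?thesis
    by (simp add: n'_def)
qed

lemma transition_refl:
  assumes gen: "generic r a" and eq: "\<And>i. i \<in> {1..r} \<Longrightarrow> k i = n i"
    and qs: "\<And>s. 1 \<le> s \<Longrightarrow> s \<le> (\<Sum>i=1..r. n i) \<Longrightarrow> th 1 (int s) \<noteq> 0"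
  shows "transition r a k n = 1"
proof -
  define N where "N = (\<Sum>i=1..r. n i)"
  have sum_k: "(\<Sum>i=1..r. k i) = N"
    unfolding N_def using eq by (intro sum.cong) auto
  have "ep 1 1 N \<noteq> 0"
  proof (rule ep_nonzero)
    fix i assume "i < N"
    then show "th 1 (1 + int i) \<noteq> 0"
      using qs [of "Suc i"] by (simp add: N_def)
  qed
  moreover have "(\<Prod>i=1..r. ep (a i) (1 + int N - int (k i)) (k i)
      * ep (a i) (1 + int N + int N - int (n i)) (n i - k i) / ep (a i) (1 + int N - int (n i)) (n i)) = 1"
  proof (intro prod.neutral ballI)
    fix i assume i: "i \<in> {1..r}"
    have "ep (a i) (1 + int N - int (n i)) (n i) \<noteq> 0"
      using gen i by (intro ep_nonzero) (auto simp: generic_def)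
    then show "ep (a i) (1 + int N - int (k i)) (k i)
      * ep (a i) (1 + int N + int N - int (n i)) (n i - k i) / ep (a i) (1 + int N - int (n i)) (n i) = 1"
      using eq [OF i] by simp
  qed
  moreover have "(\<Prod>i=1..r. \<Prod>j=1..r. ep (a i / a j) (- int (n i)) (n i - k i)
          / ep (a i / a j) (int (k j) - int (n i)) (n i - k i)) = 1"
    using eq by (intro prod.neutral ballI) simp
  ultimately show ?thesis
    unfolding transition_def Let_def sum_k N_def [symmetric] by simp
qed

text \<open>
  Splitting each weight according to the first step down from \<open>n\<close> and interchanging the sums leaves, for every \<open>m\<close>,
  the same sum for \<open>n\<close> lowered at \<open>m\<close>, weighted by \<open>first_step\<close> for \<open>k = 0\<close>. Terms with \<open>k m = n m\<close>
  drop out because \<open>first_step\<close> then contains \<open>\<theta>(1)\<close>.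
\<close>

proposition sum_transition:
  assumes gen: "generic r a"
    and qs: "\<And>s. 1 \<le> s \<Longrightarrow> s \<le> (\<Sum>i=1..r. n i) \<Longrightarrow> th 1 (int s) \<noteq> 0"
    and "M \<le> (\<Sum>i=1..r. n i)"
  shows "(\<Sum>k | k \<in> compositions r M \<and> (\<forall>i\<in>{1..r}. k i \<le> n i). transition r a k n) = 1"
  using qs assms(3)
proof (induction "(\<Sum>i=1..r. n i) - M" arbitrary: n)
  case 0
  define S where "S = {k. k \<in> compositions r M \<and> (\<forall>i\<in>{1..r}. k i \<le> n i)}"
  define k0 where "k0 = restrict n {1..r}"
  have sum_n: "(\<Sum>i=1..r. n i) = M"
    using 0 by simp
  have "k i = n i" if "k \<in> S" "i \<in> {1..r}" for k i
  proof (rule ccontr)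
    assume "k i \<noteq> n i"
    then have "(\<Sum>i=1..r. k i) < (\<Sum>i=1..r. n i)"
      using that by (intro sum_strict_mono_ex1) (auto simp: S_def intro!: bexI [of _ i] order.not_eq_order_implies_strict)
    then show False
      using that sum_n by (simp add: S_def compositions_def)
  qed
  then have S: "S \<subseteq> {k0}" and tr: "\<And>k. k \<in> S \<Longrightarrow> transition r a k n = 1"
  proof -
    assume eq: "\<And>k i. k \<in> S \<Longrightarrow> i \<in> {1..r} \<Longrightarrow> k i = n i"
    show "S \<subseteq> {k0}"
    proof
      fix k assume k: "k \<in> S"
      then have "k \<in> extensional {1..r}"
        by (auto simp: S_def compositions_def PiE_def)
      then have "k = k0"
        unfolding k0_def using eq [OF k] by (intro extensionalityI [of k "{1..r}"]) auto
      then show "k \<in> {k0}"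
        by simp
    qed
    show "transition r a k n = 1" if "k \<in> S" for k
      using gen eq [OF that] 0(2) by (intro transition_refl) auto
  qed
  moreover have "k0 \<in> S"
    using sum_n by (auto simp: S_def compositions_def k0_def)
  ultimately have "S = {k0}"
    by auto
  then show ?case
    unfolding S_def [symmetric] using tr by simp
next
  case (Suc d)
  define I where "I = {1..r}"
  define N where "N = sum n I"
  define S where "S = (\<lambda>n. {k. k \<in> compositions r M \<and> (\<forall>i\<in>I. k i \<le> n i)})"
  define n' where "n' = (\<lambda>m. n(m := n m - 1))"
  have fin_S: "finite (S n)" for n
    using finite_compositions [of r M] by (rule rev_finite_subset) (auto simp: S_def)
  have "M < N"
    using Suc by (simp add: N_def I_def)
  have qs: "th 1 (int s) \<noteq> 0" if "1 \<le> s" "s \<le> N" for s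
    using Suc.prems(1) that by (simp add: N_def I_def)
  have IH: "(\<Sum>k\<in>S (n' m). transition r a k (n' m)) = 1" if m: "m \<in> I" "n m > 0" for m
  proof -
    have "sum n I = n m + sum n (I - {m})" "sum (n' m) I = n' m m + sum (n' m) (I - {m})"
      using m by (auto intro: sum.remove simp: I_def)
    moreover have "sum (n' m) (I - {m}) = sum n (I - {m})"
      by (intro sum.cong) (auto simp: n'_def)
    ultimately have sum_n': "sum (n' m) I = N - 1"
      using m by (simp add: N_def n'_def)
    then have "d = sum (n' m) I - M"
      using Suc.hyps(2) by (simp add: N_def I_def)
    then show ?thesis
      unfolding S_def I_def
      by (rule Suc.hyps(1) [unfolded I_def]) (use qs sum_n' \<open>M < N\<close> in \<open>auto simp: I_def\<close>)
  qed
  have step: "transition r a k n * first_step r a k n m =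
      (if k m < n m then transition r a k (n' m) * first_step r a (\<lambda>_. 0) n m else 0)"
    if k: "k \<in> S n" and m: "m \<in> I" for k m
  proof (cases "k m < n m")
    case True
    then show ?thesis
      using transition_first_step [OF gen, of k M n N m] qs k m
      by (simp add: S_def N_def I_def n'_def compositions_def)
  next
    case False
    then have "k m = n m"
      using k m by (simp add: S_def order.antisym)
    then show ?thesis
      using gen m first_step_eq_0 [of m r a k n] by (auto simp: generic_def I_def)
  qed
  have "(\<Sum>k\<in>S n. transition r a k n) = (\<Sum>k\<in>S n. transition r a k n * (\<Sum>m\<in>I. first_step r a k n m))"
  proof (intro sum.cong refl)
    fix k assume k: "k \<in> S n"
    have "(\<Sum>m\<in>I. first_step r a k n m) = 1"
      unfolding I_def using gen
    proof (rule sum_first_step)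
      show "(\<Sum>i=1..r. k i) = M" "(\<Sum>i=1..r. n i) = N"
        using k by (auto simp: S_def compositions_def N_def I_def)
      show "th 1 (int N - int M) \<noteq> 0"
        using qs [of "N - M"] \<open>M < N\<close> by (simp add: of_nat_diff)
    qed
    then show "transition r a k n = transition r a k n * (\<Sum>m\<in>I. first_step r a k n m)"
      by simp
  qed
  also have "\<dots> = (\<Sum>k\<in>S n. \<Sum>m\<in>I. if k m < n m then transition r a k (n' m) * first_step r a (\<lambda>_. 0) n m else 0)"
    unfolding sum_distrib_left by (intro sum.cong refl step)
  also have "\<dots> = (\<Sum>m\<in>I. \<Sum>k\<in>S n. if k m < n m then transition r a k (n' m) * first_step r a (\<lambda>_. 0) n m else 0)"
    by (rule sum.swap)
  also have "\<dots> = (\<Sum>m\<in>I. first_step r a (\<lambda>_. 0) n m)"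
  proof (intro sum.cong refl)
    fix m assume m: "m \<in> I"
    show "(\<Sum>k\<in>S n. if k m < n m then transition r a k (n' m) * first_step r a (\<lambda>_. 0) n m else 0) =
        first_step r a (\<lambda>_. 0) n m"
    proof (cases "n m > 0")
      case True
      have "{k \<in> S n. k m < n m} = S (n' m)"
      proof -
        have "(\<forall>i\<in>I. k i \<le> n' m i) \<longleftrightarrow> (\<forall>i\<in>I. k i \<le> n i) \<and> k m < n m" for k :: "nat \<Rightarrow> nat"
        proof safe
          assume *: "\<forall>i\<in>I. k i \<le> n' m i"
          show "k m < n m"
            using * [rule_format, OF m] True by (simp add: n'_def)
          show "k i \<le> n i" if "i \<in> I" for i
            using * [rule_format, OF that] by (cases "i = m") (auto simp: n'_def)
        next
          fix i assume "\<forall>i\<in>I. k i \<le> n i" "k m < n m" "i \<in> I"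
          then show "k i \<le> n' m i"
            by (cases "i = m") (auto simp: n'_def)
        qed
        then show ?thesis
          by (auto simp: S_def)
      qed
      then have "(\<Sum>k\<in>S n. if k m < n m then transition r a k (n' m) * first_step r a (\<lambda>_. 0) n m else 0)
          = (\<Sum>k\<in>S (n' m). transition r a k (n' m)) * first_step r a (\<lambda>_. 0) n m"
        using fin_S by (simp add: sum.inter_filter [symmetric] sum_distrib_right)
      then show ?thesis
        using IH [OF m True] by simp
    next
      case False
      then show ?thesis
        using gen m first_step_eq_0 [of m r a "\<lambda>_. 0" n] by (simp add: generic_def I_def)
    qed
  qed
  also have "\<dots> = 1"
    unfolding I_def using gen
  proof (rule sum_first_step)
    show "(\<Sum>i=1..r. n i) = N"
      by (simp add: N_def I_def)
    show "th 1 (int N - int 0) \<noteq> 0"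
      using qs [of N] \<open>M < N\<close> by simp
  qed simp
  finally show ?case
    by (simp add: S_def I_def)
qed

end

section \<open>Telescoping the weights\<close>

context nome_base
begin

definition regular :: "complex \<Rightarrow> bool" where
  "regular A \<longleftrightarrow> (\<forall>s. th A s \<noteq> 0)"

text \<open>
  A solution of \<open>F(s + 1) = \<theta>(A q\<^sup>s) F(s)\<close> on all integers, the discrete counterpart of the elliptic gamma
  function. Every shifted factorial with base \<open>A\<close> becomes a quotient of two of its values, so
  cancellations between factorials of different lengths become visible.
\<close>

definition primitive :: "complex \<Rightarrow> int \<Rightarrow> complex" where
  "primitive A s = (if s \<ge> 0 then ep A 0 (nat s) else 1 / ep A s (nat (- s)))"

lemma primitive_nonzero: "regular A \<Longrightarrow> primitive A s \<noteq> 0"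
  by (simp add: primitive_def regular_def ep_nonzero)

lemma primitive_step:
  assumes "regular A"
  shows "primitive A (s + 1) = th A s * primitive A s"
proof (cases "s \<ge> 0")
  case True
  then have "nat (s + 1) = Suc (nat s)"
    by simp
  then show ?thesis
    using True ep_Suc [of A 0 "nat s"] by (simp add: primitive_def)
next
  case False
  define l where "l = nat (- (s + 1))"
  have l: "nat (- s) = Suc l" and s: "s = - int l - 1"
    using False by (simp_all add: l_def)
  have "primitive A (s + 1) = 1 / ep A (s + 1) l"
    using False by (cases "s + 1 = 0") (simp_all add: primitive_def l_def)
  moreover have "primitive A s = 1 / (th A s * ep A (s + 1) l)"
    using False unfolding primitive_def l ep_Suc_left by simp
  moreover have "th A s \<noteq> 0"
    using assms by (simp add: regular_def)
  ultimately show ?thesis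
    by simp
qed

lemma ep_primitive:
  assumes "regular A"
  shows "ep A s l = primitive A (s + int l) / primitive A s"
proof (induction l)
  case 0
  then show ?case
    using primitive_nonzero [OF assms] by simp
next
  case (Suc l)
  then show ?case
    using primitive_step [OF assms, of "s + int l"] by (simp add: ep_Suc add_ac)
qed

text \<open>
  Reflecting each factor by \<open>\<theta>(1/x) = -\<theta>(x)/x\<close> and reversing the order of the factors; the powers
  contribute \<open>q\<^bsup>-u\<^esup>\<close> per factor of the quotient. This expresses the entries of \<open>transition\<close> below the
  diagonal by \<open>a\<^sub>i/a\<^sub>j\<close> with \<open>i < j\<close>, and its diagonal by ordinary elliptic factorials.
\<close>

lemma ep_ratio_reflect:
  assumes "C \<noteq> 0"
  shows "q powi (u * int l) * (ep (1 / C) (- n) l / ep (1 / C) (u - n) l)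
       = ep C (n - int l + 1) l / ep C (n - int l + 1 - u) l"
proof (induction l)
  case 0
  then show ?case by simp
next
  case (Suc l)
  have th_inv: "th (1 / C) (- s) = - (1 / (C * q powi s)) * th C s" for s
    using theta_inverse [of "C * q powi s"] assms q_nonzero
    by (simp add: th_def power_int_minus field_simps)
  have ratio: "q powi u * (th (1 / C) (- n + int l) / th (1 / C) (u - n + int l))
      = th C (n - int l) / th C (n - int l - u)"
  proof -
    have e: "- n + int l = - (n - int l)" "u - n + int l = - (n - int l - u)"
      by simp_all
    have 1: "q powi u * ((1 / (C * q powi (n - int l))) / (1 / (C * q powi (n - int l - u)))) = 1"
      using assms q_nonzero by (simp add: power_int_diff)
    have 2: "q powi u * ((- x * y) / (- z * w)) = q powi u * (x / z) * (y / w)" for x y z w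
      by simp
    show ?thesis
      unfolding e th_inv 2 1 by simp
  qed
  have "q powi (u * int (Suc l)) = q powi u * q powi (u * int l)"
    using q_nonzero by (simp add: power_int_add distrib_left)
  then have "q powi (u * int (Suc l)) * (ep (1 / C) (- n) (Suc l) / ep (1 / C) (u - n) (Suc l))
     = (q powi u * (th (1 / C) (- n + int l) / th (1 / C) (u - n + int l)))
      * (q powi (u * int l) * (ep (1 / C) (- n) l / ep (1 / C) (u - n) l))"
    by (simp add: ep_Suc mult_ac)
  also have "\<dots> = (th C (n - int l) / th C (n - int l - u))
      * (ep C (n - int l + 1) l / ep C (n - int l + 1 - u) l)"
    unfolding ratio Suc.IH ..
  also have "\<dots> = ep C (n - int l) (Suc l) / ep C (n - int l - u) (Suc l)"
    unfolding ep_Suc_left by (simp add: algebra_simps)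
  finally show ?case
    by (simp add: algebra_simps)
qed

lemma eW_telescope:
  assumes A: "regular A" and B: "regular B" and AB: "regular (A / B)" and nz: "A \<noteq> 0" "B \<noteq> 0"
  shows "eW (A * q powi (2 * \<rho>)) (B * q powi (2 * \<rho>)) q p s t = q ^ t
    * (th A (2 * \<rho> + s + 2 * int t) / th A (2 * \<rho> + s))
    * (th B (2 * \<rho> + 2 * s - 1) * th B (2 * \<rho> + 2 * s)
       / (th B (2 * \<rho> + 2 * s + int t - 1) * th B (2 * \<rho> + 2 * s + int t)))
    * (th (A / B) (- s) * th (A / B) (1 - s) / (th (A / B) (int t - s) * th (A / B) (int t - s + 1)))"
proof (induction t)
  case 0
  have "th A z \<noteq> 0" "th B z \<noteq> 0" "th (A / B) z \<noteq> 0" for z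
    using A B AB by (auto simp: regular_def)
  then show ?case
    by (simp add: eW_def add.commute)
next
  case (Suc t)
  have th0: "th A z \<noteq> 0" "th B z \<noteq> 0" "th (A / B) z \<noteq> 0" for z
    using A B AB by (auto simp: regular_def)
  have e: "A * q powi (2 * \<rho>) * q powi z = A * q powi (2 * \<rho> + z)"
    "B * q powi (2 * \<rho>) * q powi z = B * q powi (2 * \<rho> + z)"
    "A * q powi (2 * \<rho>) * q powi z / (B * q powi (2 * \<rho>)) = A / B * q powi z" for z
    using q_nonzero nz by (simp_all add: power_int_add)
  have "ew (A * q powi (2 * \<rho>)) (B * q powi (2 * \<rho>)) q p s (int (Suc t)) =
     th A (2 * \<rho> + (s + 2 * int (Suc t))) * th B (2 * \<rho> + (2 * s + int (Suc t) - 2)) * th (A / B) (int (Suc t) - s - 1)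
     / (th A (2 * \<rho> + (s + 2 * int (Suc t) - 2)) * th B (2 * \<rho> + (2 * s + int (Suc t))) * th (A / B) (int (Suc t) - s + 1)) * q"
    unfolding ew_def e(3) unfolding e(1,2) by (simp only: thetas_def th_def list.map prod_list.Cons prod_list.Nil mult.assoc mult_1_right)
  also have "\<dots> = th A (2 * \<rho> + s + 2 * int (Suc t)) / th A (2 * \<rho> + s + 2 * int t)
     * (th B (2 * \<rho> + 2 * s + int t - 1) / th B (2 * \<rho> + 2 * s + int (Suc t)))
     * (th (A / B) (int t - s) / th (A / B) (int (Suc t) - s + 1)) * q"
    by (simp add: algebra_simps)
  finally have ew_Suc: "ew (A * q powi (2 * \<rho>)) (B * q powi (2 * \<rho>)) q p s (int (Suc t)) = \<dots>" .
  define T where "T = int (Suc t)"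
  have T: "2 * \<rho> + 2 * s + int t = 2 * \<rho> + 2 * s + T - 1" "int t - s + 1 = T - s"
    by (simp_all add: T_def)
  have "eW (A * q powi (2 * \<rho>)) (B * q powi (2 * \<rho>)) q p s (Suc t) =
      eW (A * q powi (2 * \<rho>)) (B * q powi (2 * \<rho>)) q p s t * ew (A * q powi (2 * \<rho>)) (B * q powi (2 * \<rho>)) q p s (int (Suc t))"
    by (simp add: eW_def)
  also have "\<dots> = q ^ Suc t
    * (th A (2 * \<rho> + s + 2 * T) / th A (2 * \<rho> + s))
    * (th B (2 * \<rho> + 2 * s - 1) * th B (2 * \<rho> + 2 * s)
       / (th B (2 * \<rho> + 2 * s + T - 1) * th B (2 * \<rho> + 2 * s + T)))
    * (th (A / B) (- s) * th (A / B) (1 - s) / (th (A / B) (T - s) * th (A / B) (T - s + 1)))"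
    unfolding ew_Suc Suc.IH unfolding T_def [symmetric] unfolding T using th0 by (simp add: mult_ac)
  finally show ?case
    unfolding T_def .
qed

text \<open>
  The three groups are the contributions of the three theta quotients in the weight. Increasing
  \<open>l\<close> by one moves the arguments of the two theta factors in \<open>B\<close> by two steps, so that they fill a run without
  gaps; the two in \<open>A / B\<close> move by one step, which is why \<open>primitive (A / B)\<close> occurs in pairs of
  neighbouring values.
\<close>

lemma bigQ_telescope:
  assumes A: "regular A" and B: "regular B" and AB: "regular (A / B)" and nz: "A \<noteq> 0" "B \<noteq> 0"
  shows "bigQ A B q p l \<rho> s t = q ^ (t * l)
    * (primitive A (2 * \<rho> + s + int l + 1 + 2 * int t) / primitive A (2 * \<rho> + s + int l + 1)
       / (primitive A (2 * \<rho> + s + 1 + 2 * int t) / primitive A (2 * \<rho> + s + 1)))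
    * (primitive B (2 * \<rho> + 2 * s + 2 * int l + 1) / primitive B (2 * \<rho> + 2 * s + 2 * int l + 1 + int t)
       / (primitive B (2 * \<rho> + 2 * s + 1) / primitive B (2 * \<rho> + 2 * s + 1 + int t)))
    * (primitive (A / B) (1 - s) * primitive (A / B) (- s)
       / (primitive (A / B) (1 - s - int l) * primitive (A / B) (- s - int l))
       / (primitive (A / B) (1 - s + int t) * primitive (A / B) (- s + int t)
       / (primitive (A / B) (1 - s - int l + int t) * primitive (A / B) (- s - int l + int t))))"
proof (induction l)
  case 0
  then show ?case
    using primitive_nonzero A B AB by (simp add: bigQ_def)
next
  case (Suc l)
  note nonzero = primitive_nonzero [OF A] primitive_nonzero [OF B] primitive_nonzero [OF AB]
  have th0: "th A z \<noteq> 0" "th B z \<noteq> 0" "th (A / B) z \<noteq> 0" for z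
    using A B AB by (auto simp: regular_def)
  have step: "primitive A (2 * \<rho> + s + int (Suc l) + 1 + 2 * int t) =
      th A (2 * \<rho> + s + int l + 1 + 2 * int t) * primitive A (2 * \<rho> + s + int l + 1 + 2 * int t)"
    "primitive A (2 * \<rho> + s + int (Suc l) + 1) =
      th A (2 * \<rho> + s + int l + 1) * primitive A (2 * \<rho> + s + int l + 1)"
    "primitive B (2 * \<rho> + 2 * s + 2 * int (Suc l) + 1) =
      th B (2 * \<rho> + 2 * s + 2 * int l + 2) * th B (2 * \<rho> + 2 * s + 2 * int l + 1)
      * primitive B (2 * \<rho> + 2 * s + 2 * int l + 1)"
    "primitive B (2 * \<rho> + 2 * s + 2 * int (Suc l) + 1 + int t) =
      th B (2 * \<rho> + 2 * s + 2 * int l + 2 + int t) * th B (2 * \<rho> + 2 * s + 2 * int l + 1 + int t)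
      * primitive B (2 * \<rho> + 2 * s + 2 * int l + 1 + int t)"
    "primitive (A / B) (1 - s - int l) = th (A / B) (- s - int l) * primitive (A / B) (- s - int l)"
    "primitive (A / B) (- s - int l) = th (A / B) (- s - int (Suc l)) * primitive (A / B) (- s - int (Suc l))"
    "primitive (A / B) (1 - s - int l + int t) = th (A / B) (- s - int l + int t) * primitive (A / B) (- s - int l + int t)"
    "primitive (A / B) (- s - int l + int t) = th (A / B) (- s - int (Suc l) + int t) * primitive (A / B) (- s - int (Suc l) + int t)"
    using primitive_step [OF A, of "2 * \<rho> + s + int l + 1 + 2 * int t"]
      primitive_step [OF A, of "2 * \<rho> + s + int l + 1"]
      primitive_step [OF B, of "2 * \<rho> + 2 * s + 2 * int l + 2"]
      primitive_step [OF B, of "2 * \<rho> + 2 * s + 2 * int l + 1"]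
      primitive_step [OF B, of "2 * \<rho> + 2 * s + 2 * int l + 2 + int t"]
      primitive_step [OF B, of "2 * \<rho> + 2 * s + 2 * int l + 1 + int t"]
      primitive_step [OF AB, of "- s - int l"] primitive_step [OF AB, of "- s - int (Suc l)"]
      primitive_step [OF AB, of "- s - int l + int t"] primitive_step [OF AB, of "- s - int (Suc l) + int t"]
    by (simp_all add: algebra_simps)
  have sh: "1 - s - int (Suc l) = - s - int l" "1 - s - int (Suc l) + int t = - s - int l + int t"
    by simp_all
  have bigQ_Suc: "bigQ A B q p (Suc l) \<rho> s t =
      bigQ A B q p l \<rho> s t * eW (A * q powi (2 * \<rho>)) (B * q powi (2 * \<rho>)) q p (int (Suc l) + s) t"
    by (simp add: bigQ_def eW_shift_def)
  have eW: "eW (A * q powi (2 * \<rho>)) (B * q powi (2 * \<rho>)) q p (int (Suc l) + s) t = q ^ t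
    * (th A (2 * \<rho> + s + int l + 1 + 2 * int t) / th A (2 * \<rho> + s + int l + 1))
    * (th B (2 * \<rho> + 2 * s + 2 * int l + 1) * th B (2 * \<rho> + 2 * s + 2 * int l + 2)
       / (th B (2 * \<rho> + 2 * s + 2 * int l + 1 + int t) * th B (2 * \<rho> + 2 * s + 2 * int l + 2 + int t)))
    * (th (A / B) (- s - int (Suc l)) * th (A / B) (- s - int l)
       / (th (A / B) (- s - int (Suc l) + int t) * th (A / B) (- s - int l + int t)))"
    unfolding eW_telescope [OF assms]
    by (intro arg_cong2 [where f = "(*)"] arg_cong2 [where f = "(/)"] arg_cong2 [where f = th] refl) simp_all
  define L where "L = int (Suc l)"
  show ?case
    unfolding bigQ_Suc eW Suc.IH unfolding sh step(1-4) unfolding step(5,7) unfolding step(6,8)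
    unfolding L_def [symmetric] using th0 nonzero
    by (simp add: power_add mult_ac)
qed

end

section \<open>The convolution summand in closed form\<close>

lemma prod_square_split:
  fixes f :: "nat \<Rightarrow> nat \<Rightarrow> complex"
  shows "(\<Prod>i=1..r. \<Prod>j=1..r. f i j) = (\<Prod>i=1..r. f i i) * (\<Prod>j=1..r. \<Prod>i\<in>{1..<j}. f i j * f j i)"
proof (induction r)
  case 0
  then show ?case by simp
next
  case (Suc r)
  have "(\<Prod>i=1..Suc r. \<Prod>j=1..Suc r. f i j) = (\<Prod>i=1..r. \<Prod>j=1..r. f i j)
      * (\<Prod>i=1..r. f i (Suc r)) * (\<Prod>j=1..r. f (Suc r) j) * f (Suc r) (Suc r)"
    by (simp add: prod.distrib mult_ac)
  then show ?case
    unfolding Suc.IH by (simp add: prod.distrib atLeastLessThanSuc_atLeastAtMost mult_ac)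
qed

lemma prod_pairs_swap:
  fixes f :: "nat \<Rightarrow> nat \<Rightarrow> complex"
  shows "(\<Prod>j=1..r. \<Prod>i\<in>{1..<j}. f i j) = (\<Prod>i=1..r. \<Prod>j\<in>{i<..r}. f i j)"
proof -
  have "(\<Prod>j=1..r. \<Prod>i\<in>{1..<j}. f i j) = (\<Prod>j=1..r. \<Prod>i | i \<in> {1..r} \<and> i < j. f i j)"
    by (intro prod.cong refl) auto
  also have "\<dots> = (\<Prod>i=1..r. \<Prod>j | j \<in> {1..r} \<and> i < j. f i j)"
    by (rule prod.swap_restrict) auto
  also have "\<dots> = (\<Prod>i=1..r. \<Prod>j\<in>{i<..r}. f i j)"
    by (intro prod.cong refl) auto
  finally show ?thesis .
qed

lemma prod_quotient_telescope:
  fixes f :: "nat \<Rightarrow> complex"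
  assumes "a \<le> b" "\<And>j. f j \<noteq> 0"
  shows "(\<Prod>j\<in>{a<..b}. f j / f (j - 1)) = f b / f a"
  using assms(1)
proof (induction b rule: dec_induct)
  case base
  then show ?case
    using assms(2) by simp
next
  case (step b)
  then have "{a<..Suc b} = insert (Suc b) {a<..b}"
    by auto
  then show ?case
    using step assms(2) by simp
qed

lemma psum_0 [simp]: "psum k 0 = 0"
  by (simp add: psum_def)

lemma psum_step: "i \<ge> 1 \<Longrightarrow> psum k i = psum k (i - 1) + k i"
  by (cases i) (simp_all add: psum_def)

lemma psum_diff: "psum (\<lambda>i. k i - l i) i = psum k i - psum l i"
  by (simp add: psum_def sum_subtractf)

lemma psum_int: "psum (\<lambda>i. int (k i)) i = int (\<Sum>\<nu>=1..i. k \<nu>)"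
  by (simp add: psum_def)

context nome_base
begin

lemma generic_regular:
  assumes "generic r a" "i \<in> {1..r}"
  shows "a i \<noteq> 0" "regular (a i)" "j \<in> {1..r} \<Longrightarrow> i \<noteq> j \<Longrightarrow> regular (a i / a j)"
  using assms by (auto simp: generic_def regular_def)

lemma emultinom_primitive:
  assumes gen: "generic r a" and k: "\<And>i. i \<in> {1..r} \<Longrightarrow> k i \<ge> 0"
  shows "emultinom r (\<lambda>i. a i * q powi e i) q p k =
    ep 1 1 (nat (psum k r)) / (\<Prod>i=1..r. ep 1 1 (nat (k i)))
    * (\<Prod>i=1..r. primitive (a i) (e i + 1 + psum k r) / primitive (a i) (e i + 1 + psum k r - k i)
        / (primitive (a i) (e i + 1 + 2 * psum k (i - 1) + k i) / primitive (a i) (e i + 1 + 2 * psum k (i - 1))))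
    * (\<Prod>j=1..r. \<Prod>i\<in>{1..<j}.
        primitive (a i / a j) (e i - e j + 1 - k i + k j) / primitive (a i / a j) (e i - e j + 1 - k i)
        / (primitive (a i / a j) (e i - e j + 1 + k j) / primitive (a i / a j) (e i - e j + 1)))"
proof -
  have k': "int (nat (k i)) = k i" if "i \<in> {1..r}" for i
    using k that by simp
  have 1: "epoch (a i * q powi e i * q powi s) q p l = ep (a i) (e i + s) l" for i s l
    using q_nonzero by (simp add: ep_def power_int_add mult.assoc)
  have 2: "epoch (a i * q powi e i * q powi s / (a j * q powi e j)) q p l = ep (a i / a j) (e i - e j + s) l" for i j s l
    using q_nonzero by (simp add: ep_def power_int_add power_int_diff mult.assoc)
  have 3: "epoch (a i * q powi e i * q / (a j * q powi e j)) q p l = ep (a i / a j) (e i - e j + 1) l" for i j l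
    using 2 [of i 1 j l] by simp
  have A: "(\<Prod>i=1..r. epoch (a i * q powi e i * q powi (1 + psum k r - k i)) q p (nat (k i))
                   / epoch (a i * q powi e i * q powi (1 + 2 * psum k (i - 1))) q p (nat (k i)))
     = (\<Prod>i=1..r. primitive (a i) (e i + 1 + psum k r) / primitive (a i) (e i + 1 + psum k r - k i)
        / (primitive (a i) (e i + 1 + 2 * psum k (i - 1) + k i) / primitive (a i) (e i + 1 + 2 * psum k (i - 1))))"
  proof (intro prod.cong refl)
    fix i assume i: "i \<in> {1..r}"
    show "epoch (a i * q powi e i * q powi (1 + psum k r - k i)) q p (nat (k i))
                   / epoch (a i * q powi e i * q powi (1 + 2 * psum k (i - 1))) q p (nat (k i))
     = primitive (a i) (e i + 1 + psum k r) / primitive (a i) (e i + 1 + psum k r - k i)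
        / (primitive (a i) (e i + 1 + 2 * psum k (i - 1) + k i) / primitive (a i) (e i + 1 + 2 * psum k (i - 1)))"
      unfolding 1 ep_primitive [OF generic_regular(2) [OF gen i]] k' [OF i]
      by (intro arg_cong2 [where f = "(/)"] arg_cong2 [where f = primitive] refl) simp_all
  qed
  have B: "(\<Prod>j=1..r. \<Prod>i\<in>{1..<j}.
            epoch (a i * q powi e i * q powi (1 - k i) / (a j * q powi e j)) q p (nat (k j))
            / epoch (a i * q powi e i * q / (a j * q powi e j)) q p (nat (k j)))
     = (\<Prod>j=1..r. \<Prod>i\<in>{1..<j}.
        primitive (a i / a j) (e i - e j + 1 - k i + k j) / primitive (a i / a j) (e i - e j + 1 - k i)
        / (primitive (a i / a j) (e i - e j + 1 + k j) / primitive (a i / a j) (e i - e j + 1)))"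
  proof (intro prod.cong refl)
    fix i j assume j: "j \<in> {1..r}" and "i \<in> {1..<j}"
    then have i: "i \<in> {1..r}" "i \<noteq> j"
      by auto
    show "epoch (a i * q powi e i * q powi (1 - k i) / (a j * q powi e j)) q p (nat (k j))
            / epoch (a i * q powi e i * q / (a j * q powi e j)) q p (nat (k j))
     = primitive (a i / a j) (e i - e j + 1 - k i + k j) / primitive (a i / a j) (e i - e j + 1 - k i)
        / (primitive (a i / a j) (e i - e j + 1 + k j) / primitive (a i / a j) (e i - e j + 1))"
      unfolding 2 3 ep_primitive [OF generic_regular(3) [OF gen i(1) j i(2)]] k' [OF j]
      by (intro arg_cong2 [where f = "(/)"] arg_cong2 [where f = primitive] refl) simp_all
  qed
  have "\<not> (\<exists>j\<in>{1..r}. k j < 0)"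
    using k by (auto simp: not_less)
  then show ?thesis
    unfolding emultinom_def epoch_q A B by simp
qed

text \<open>
  With the shift \<open>\<rho>\<close> of the convolution formula, the \<open>a\<^sub>i\<close>-part is a quotient of consecutive terms in
  \<open>j\<close> and the \<open>a\<^sub>j\<close>-part one of consecutive terms in \<open>i\<close>, so both collapse in the product over
  all pairs.
\<close>

lemma bigQ_pair:
  fixes n k :: "nat \<Rightarrow> nat"
  defines "N \<equiv> psum (\<lambda>i. int (n i))" and "K \<equiv> psum (\<lambda>i. int (k i))"
  assumes gen: "generic r a" and ij: "j \<in> {1..r}" "i \<in> {1..<j}" and le: "k i \<le> n i"
  defines "g \<equiv> \<lambda>u. primitive (a i) (2 * u + 1 + int (n i)) / primitive (a i) (2 * u + 1 + int (k i))"
    and "h \<equiv> \<lambda>v. primitive (a j) (2 * v + 1) / primitive (a j) (2 * v + 1 + int (k j))"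
    and "c \<equiv> primitive (a i / a j)"
  shows "bigQ (a i) (a j) q p (n i - k i) (N (i - 1) + K (j - 1) - K i) (int (k i)) (k j)
    = g (N (i - 1) + K j - K i) / g (N (i - 1) + K (j - 1) - K i)
      * (h (N i + K (j - 1) - K i) / h (N (i - 1) + K (j - 1) - K (i - 1)))
      * (q ^ (k j * (n i - k i)) * (c (1 - int (k i)) * c (- int (k i)) / (c (1 - int (n i)) * c (- int (n i)))
       / (c (1 - int (k i) + int (k j)) * c (- int (k i) + int (k j))
       / (c (1 - int (n i) + int (k j)) * c (- int (n i) + int (k j))))))"
proof -
  have i: "i \<in> {1..r}" "i \<noteq> j"
    using ij by auto
  have steps: "K j = K (j - 1) + int (k j)" "K i = K (i - 1) + int (k i)" "N i = N (i - 1) + int (n i)"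
    using ij unfolding K_def N_def by (intro psum_step; simp)+
  have l: "int (n i - k i) = int (n i) - int (k i)"
    using le by simp
  note reg = generic_regular [OF gen]
  define \<rho> where "\<rho> = N (i - 1) + K (j - 1) - K i"
  have "bigQ (a i) (a j) q p (n i - k i) \<rho> (int (k i)) (k j) = q ^ (k j * (n i - k i))
    * (primitive (a i) (2 * (N (i - 1) + K j - K i) + 1 + int (n i)) / primitive (a i) (2 * \<rho> + 1 + int (n i))
       / (primitive (a i) (2 * (N (i - 1) + K j - K i) + 1 + int (k i)) / primitive (a i) (2 * \<rho> + 1 + int (k i))))
    * (h (N i + K (j - 1) - K i) / h (N (i - 1) + K (j - 1) - K (i - 1)))
    * (c (1 - int (k i)) * c (- int (k i)) / (c (1 - int (n i)) * c (- int (n i)))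
       / (c (1 - int (k i) + int (k j)) * c (- int (k i) + int (k j))
       / (c (1 - int (n i) + int (k j)) * c (- int (n i) + int (k j)))))"
    unfolding bigQ_telescope [OF reg(2) [OF i(1)] reg(2) [OF ij(1)] reg(3) [OF i(1) ij(1) i(2)]
        reg(1) [OF i(1)] reg(1) [OF ij(1)]] h_def c_def l
    by (intro arg_cong2 [where f = "(*)"] arg_cong2 [where f = "(/)"] arg_cong2 [where f = primitive] refl)
       (simp_all add: steps \<rho>_def)
  then show ?thesis
    unfolding \<rho>_def [symmetric] g_def by (simp add: mult_ac)
qed

text \<open>
  After the telescoping, the factors that involve a single \<open>a\<^sub>i\<close>, those that involve a ratio
  \<open>a\<^sub>i/a\<^sub>j\<close>, and the factorials in \<open>q\<close> can be compared separately.
\<close>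

lemma conv_term_generic:
  assumes gen: "generic r a" and sums: "(\<Sum>i=1..r. k i) = M" "(\<Sum>i=1..r. n i) = N"
    and qs: "\<And>s. 1 \<le> s \<Longrightarrow> s \<le> N \<Longrightarrow> th 1 (int s) \<noteq> 0"
    and le: "\<And>i. i \<in> {1..r} \<Longrightarrow> k i \<le> n i"
  shows "conv_term r a q p M n k = emultinom r a q p (\<lambda>i. int (n i)) * transition r a k n"
proof -
  define P where "P = (\<lambda>f. \<Prod>i=1..r. f i :: complex)"
  define PP where "PP = (\<lambda>f. \<Prod>j=1..r. \<Prod>i\<in>{1..<j}. f i j :: complex)"
  have P_mult: "P f * P g = P (\<lambda>i. f i * g i)" for f g
    by (simp add: P_def prod.distrib)
  have PP_mult: "PP f * PP g = PP (\<lambda>i j. f i j * g i j)" for f g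
    by (simp add: PP_def prod.distrib)
  have P_cong: "P f = P g" if "\<And>i. i \<in> {1..r} \<Longrightarrow> f i = g i" for f g
    unfolding P_def using that by (rule prod.cong [OF refl])
  have PP_cong: "PP f = PP g" if "\<And>i j. j \<in> {1..r} \<Longrightarrow> i \<in> {1..<j} \<Longrightarrow> f i j = g i j" for f g
    unfolding PP_def using that by (intro prod.cong refl)
  define Ns where "Ns = psum (\<lambda>i. int (n i))"
  define Ks where "Ks = psum (\<lambda>i. int (k i))"
  have Ns_r: "Ns r = int N" and Ks_r: "Ks r = int M"
    using sums by (simp_all add: Ns_def Ks_def psum_int)
  have M_le_N: "M \<le> N"
    unfolding sums [symmetric] using le by (intro sum_mono) auto
  note reg = generic_regular [OF gen]
  have prim0: "primitive (a i) s \<noteq> 0" if "i \<in> {1..r}" for i s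
    using reg(2) [OF that] by (rule primitive_nonzero)
  \<comment> \<open>The terms of the two telescoping products: \<open>g i\<close> along \<open>j\<close>, \<open>h j\<close> along \<open>i\<close>; \<open>C\<close> is the part of
    the big weights that stays.\<close>
  define g where "g = (\<lambda>i u. primitive (a i) (2 * u + 1 + int (n i)) / primitive (a i) (2 * u + 1 + int (k i)))"
  define h where "h = (\<lambda>j v. primitive (a j) (2 * v + 1) / primitive (a j) (2 * v + 1 + int (k j)))"
  define c where "c = (\<lambda>i j. primitive (a i / a j))"
  define C where "C = (\<lambda>i j. q ^ (k j * (n i - k i))
      * (c i j (1 - int (k i)) * c i j (- int (k i)) / (c i j (1 - int (n i)) * c i j (- int (n i)))
       / (c i j (1 - int (k i) + int (k j)) * c i j (- int (k i) + int (k j))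
       / (c i j (1 - int (n i) + int (k j)) * c i j (- int (n i) + int (k j))))))"
  have c0: "c i j s \<noteq> 0" if "j \<in> {1..r}" "i \<in> {1..<j}" for i j s
    unfolding c_def using that reg(3) [of i j] by (intro primitive_nonzero) auto

  have Q: "(\<Prod>j=1..r. \<Prod>i\<in>{1..<j}. bigQ (a i) (a j) q p (n i - k i) (Ns (i - 1) + Ks (j - 1) - Ks i) (int (k i)) (k j))
     = P (\<lambda>i. g i (Ns (i - 1) + int M - Ks i) / g i (Ns (i - 1)) * (h i (Ns (i - 1)) / h i (Ks (i - 1)))) * PP C"
  proof -
    have "(\<Prod>j=1..r. \<Prod>i\<in>{1..<j}. bigQ (a i) (a j) q p (n i - k i) (Ns (i - 1) + Ks (j - 1) - Ks i) (int (k i)) (k j))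
      = PP (\<lambda>i j. g i (Ns (i - 1) + Ks j - Ks i) / g i (Ns (i - 1) + Ks (j - 1) - Ks i)
         * (h j (Ns i + Ks (j - 1) - Ks i) / h j (Ns (i - 1) + Ks (j - 1) - Ks (i - 1))) * C i j)"
      unfolding PP_def
    proof (intro prod.cong refl)
      fix i j assume ij: "j \<in> {1..r}" "i \<in> {1..<j}"
      then show "bigQ (a i) (a j) q p (n i - k i) (Ns (i - 1) + Ks (j - 1) - Ks i) (int (k i)) (k j) =
         g i (Ns (i - 1) + Ks j - Ks i) / g i (Ns (i - 1) + Ks (j - 1) - Ks i)
         * (h j (Ns i + Ks (j - 1) - Ks i) / h j (Ns (i - 1) + Ks (j - 1) - Ks (i - 1))) * C i j"
        unfolding Ns_def Ks_def g_def h_def C_def c_def using gen le by (intro bigQ_pair) auto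
    qed
    also have "\<dots> = PP (\<lambda>i j. g i (Ns (i - 1) + Ks j - Ks i) / g i (Ns (i - 1) + Ks (j - 1) - Ks i))
       * PP (\<lambda>i j. h j (Ns i + Ks (j - 1) - Ks i) / h j (Ns (i - 1) + Ks (j - 1) - Ks (i - 1))) * PP C"
      unfolding PP_mult ..
    also have "PP (\<lambda>i j. g i (Ns (i - 1) + Ks j - Ks i) / g i (Ns (i - 1) + Ks (j - 1) - Ks i))
        = P (\<lambda>i. g i (Ns (i - 1) + int M - Ks i) / g i (Ns (i - 1)))"
      unfolding PP_def prod_pairs_swap P_def
    proof (intro prod.cong refl)
      fix i assume i: "i \<in> {1..r}"
      have "g i u \<noteq> 0" for u
        using prim0 [OF i] by (simp add: g_def)
      then show "(\<Prod>j\<in>{i<..r}. g i (Ns (i - 1) + Ks j - Ks i) / g i (Ns (i - 1) + Ks (j - 1) - Ks i))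
          = g i (Ns (i - 1) + int M - Ks i) / g i (Ns (i - 1))"
        using prod_quotient_telescope [of i r "\<lambda>j. g i (Ns (i - 1) + Ks j - Ks i)"] i by (simp add: Ks_r)
    qed
    also have "PP (\<lambda>i j. h j (Ns i + Ks (j - 1) - Ks i) / h j (Ns (i - 1) + Ks (j - 1) - Ks (i - 1)))
        = P (\<lambda>j. h j (Ns (j - 1)) / h j (Ks (j - 1)))"
      unfolding PP_def P_def
    proof (intro prod.cong refl)
      fix j assume j: "j \<in> {1..r}"
      have "h j u \<noteq> 0" for u
        using prim0 [OF j] by (simp add: h_def)
      moreover have "{1..<j} = {0<..j - 1}"
        using j by auto
      ultimately show "(\<Prod>i\<in>{1..<j}. h j (Ns i + Ks (j - 1) - Ks i) / h j (Ns (i - 1) + Ks (j - 1) - Ks (i - 1)))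
          = h j (Ns (j - 1)) / h j (Ks (j - 1))"
        using prod_quotient_telescope [of 0 "j - 1" "\<lambda>i. h j (Ns i + Ks (j - 1) - Ks i)"]
        by (simp add: Ns_def Ks_def)
    qed
    finally show ?thesis
      unfolding P_mult .
  qed

  have c_n: "emultinom r a q p (\<lambda>i. int (n i)) = ep 1 1 N / P (\<lambda>i. ep 1 1 (n i))
    * P (\<lambda>i. primitive (a i) (1 + int N) / primitive (a i) (1 + int N - int (n i))
        / (primitive (a i) (1 + 2 * Ns (i - 1) + int (n i)) / primitive (a i) (1 + 2 * Ns (i - 1))))
    * PP (\<lambda>i j. c i j (1 - int (n i) + int (n j)) / c i j (1 - int (n i)) / (c i j (1 + int (n j)) / c i j 1))"
    using emultinom_primitive [OF gen, of "\<lambda>i. int (n i)" "\<lambda>_. 0"]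
    unfolding Ns_def [symmetric] Ns_r by (simp add: P_def PP_def c_def)
  have c_k: "emultinom r a q p (\<lambda>i. int (k i)) = ep 1 1 M / P (\<lambda>i. ep 1 1 (k i))
    * P (\<lambda>i. primitive (a i) (1 + int M) / primitive (a i) (1 + int M - int (k i))
        / (primitive (a i) (1 + 2 * Ks (i - 1) + int (k i)) / primitive (a i) (1 + 2 * Ks (i - 1))))
    * PP (\<lambda>i j. c i j (1 - int (k i) + int (k j)) / c i j (1 - int (k i)) / (c i j (1 + int (k j)) / c i j 1))"
    using emultinom_primitive [OF gen, of "\<lambda>i. int (k i)" "\<lambda>_. 0"]
    unfolding Ks_def [symmetric] Ks_r by (simp add: P_def PP_def c_def)
  have c_nk: "emultinom r (shifted_params a q M k) q p (\<lambda>i. int (n i) - int (k i)) =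
    ep 1 1 (N - M) / P (\<lambda>i. ep 1 1 (n i - k i))
    * P (\<lambda>i. primitive (a i) (1 + int N + int M - int (k i)) / primitive (a i) (1 + int N + int M - int (n i))
        / (primitive (a i) (2 * (Ns (i - 1) + int M - Ks i) + 1 + int (n i))
           / primitive (a i) (2 * (Ns (i - 1) + int M - Ks i) + 1 + int (k i))))
    * PP (\<lambda>i j. c i j (1 - int (n i) + int (n j)) / c i j (1 - int (n i) + int (k j))
        / (c i j (1 - int (k i) + int (n j)) / c i j (1 - int (k i) + int (k j))))"
  proof -
    have "emultinom r (\<lambda>i. a i * q powi (2 * int M - int (k i))) q p (\<lambda>i. int (n i) - int (k i)) =
      ep 1 1 (nat (int N - int M)) / P (\<lambda>i. ep 1 1 (nat (int (n i) - int (k i))))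
      * P (\<lambda>i. primitive (a i) (2 * int M - int (k i) + 1 + (int N - int M))
          / primitive (a i) (2 * int M - int (k i) + 1 + (int N - int M) - (int (n i) - int (k i)))
        / (primitive (a i) (2 * int M - int (k i) + 1 + 2 * (Ns (i - 1) - Ks (i - 1)) + (int (n i) - int (k i)))
          / primitive (a i) (2 * int M - int (k i) + 1 + 2 * (Ns (i - 1) - Ks (i - 1)))))
      * PP (\<lambda>i j. c i j (2 * int M - int (k i) - (2 * int M - int (k j)) + 1 - (int (n i) - int (k i)) + (int (n j) - int (k j)))
          / c i j (2 * int M - int (k i) - (2 * int M - int (k j)) + 1 - (int (n i) - int (k i)))
        / (c i j (2 * int M - int (k i) - (2 * int M - int (k j)) + 1 + (int (n j) - int (k j)))
          / c i j (2 * int M - int (k i) - (2 * int M - int (k j)) + 1)))"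
      unfolding P_def PP_def c_def Ns_def Ks_def Ns_r [unfolded Ns_def, symmetric] Ks_r [unfolded Ks_def, symmetric]
        psum_diff [symmetric]
      by (rule emultinom_primitive [OF gen]) (use le in simp)
    also have "\<dots> = ep 1 1 (N - M) / P (\<lambda>i. ep 1 1 (n i - k i))
    * P (\<lambda>i. primitive (a i) (1 + int N + int M - int (k i)) / primitive (a i) (1 + int N + int M - int (n i))
        / (primitive (a i) (2 * (Ns (i - 1) + int M - Ks i) + 1 + int (n i))
           / primitive (a i) (2 * (Ns (i - 1) + int M - Ks i) + 1 + int (k i))))
    * PP (\<lambda>i j. c i j (1 - int (n i) + int (n j)) / c i j (1 - int (n i) + int (k j))
        / (c i j (1 - int (k i) + int (n j)) / c i j (1 - int (k i) + int (k j))))"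
    proof (unfold c_def, intro arg_cong2 [where f = "(*)"] arg_cong2 [where f = "(/)"] P_cong PP_cong)
      fix i assume "i \<in> {1..r}"
      then have Ks_i: "Ks i = Ks (i - 1) + int (k i)"
        unfolding Ks_def by (intro psum_step) simp
      show "primitive (a i) (2 * int M - int (k i) + 1 + 2 * (Ns (i - 1) - Ks (i - 1)) + (int (n i) - int (k i)))
          = primitive (a i) (2 * (Ns (i - 1) + int M - Ks i) + 1 + int (n i))"
        "primitive (a i) (2 * int M - int (k i) + 1 + 2 * (Ns (i - 1) - Ks (i - 1)))
          = primitive (a i) (2 * (Ns (i - 1) + int M - Ks i) + 1 + int (k i))"
        unfolding Ks_i by (intro arg_cong2 [where f = primitive] refl; simp)+
    qed ((intro arg_cong2 [where f = primitive] arg_cong [where f = "ep 1 1"] refl; linarith)+)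
    finally show ?thesis
      unfolding shifted_params_def [abs_def] .
  qed

  define T where "T = (\<lambda>i j. q ^ (k j * (n i - k i)) * (ep (a i / a j) (- int (n i)) (n i - k i)
          / ep (a i / a j) (int (k j) - int (n i)) (n i - k i)))"
  define S where "S = (\<lambda>i. primitive (a i) (1 + int M) / primitive (a i) (1 + int M - int (k i))
     * (primitive (a i) (1 + int N + int M - int (k i)) / primitive (a i) (1 + int N + int M - int (n i)))
     / (primitive (a i) (1 + int N) / primitive (a i) (1 + int N - int (n i))))"
  have tr: "transition r a k n = ep 1 1 M * ep 1 1 (N - M) / ep 1 1 N * P S * (P (\<lambda>i. T i i) * PP (\<lambda>i j. T i j * T j i))"
  proof -
    have "P S = (\<Prod>i=1..r. ep (a i) (1 + int M - int (k i)) (k i)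
          * ep (a i) (1 + int N + int M - int (n i)) (n i - k i)
          / ep (a i) (1 + int N - int (n i)) (n i))"
      unfolding P_def
    proof (intro prod.cong refl)
      fix i assume i: "i \<in> {1..r}"
      have l: "int (n i - k i) = int (n i) - int (k i)"
        using le [OF i] by simp
      show "S i = ep (a i) (1 + int M - int (k i)) (k i)
          * ep (a i) (1 + int N + int M - int (n i)) (n i - k i) / ep (a i) (1 + int N - int (n i)) (n i)"
        unfolding S_def ep_primitive [OF reg(2) [OF i]] l
        by (intro arg_cong2 [where f = "(*)"] arg_cong2 [where f = "(/)"] arg_cong2 [where f = primitive] refl)
           simp_all
    qed
    moreover have "(\<Prod>i=1..r. \<Prod>j=1..r. q ^ (k j * (n i - k i))) = q ^ (M * (N - M))"
    proof -
      have "(\<Sum>i=1..r. n i - k i) = N - M"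
        unfolding sums [symmetric] using le by (intro sum_subtractf_nat) auto
      then have "(\<Sum>i=1..r. \<Sum>j=1..r. k j * (n i - k i)) = M * (N - M)"
        using sums by (simp flip: sum_distrib_left sum_distrib_right)
      then show ?thesis
        by (simp flip: power_sum)
    qed
    ultimately show ?thesis
      unfolding transition_def Let_def sums P_def PP_def prod_square_split [symmetric]
      unfolding T_def prod.distrib by (simp add: mult_ac)
  qed

  have ep0: "ep 1 1 l \<noteq> 0" if "l \<le> N" for l
  proof (rule ep_nonzero)
    fix i assume "i < l"
    then show "th 1 (1 + int i) \<noteq> 0"
      using qs [of "Suc i"] that by simp
  qed
  have diag: "T i i = ep 1 1 (n i) / (ep 1 1 (k i) * ep 1 1 (n i - k i))" if i: "i \<in> {1..r}" for i
  proof -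
    have n_le: "n i \<le> N"
      unfolding sums(2) [symmetric] using i by (intro member_le_sum) auto
    have "q ^ (k i * (n i - k i)) = q powi (int (k i) * int (n i - k i))"
      by (metis of_nat_mult power_int_of_nat)
    then have "T i i = ep 1 (int (n i) - int (n i - k i) + 1) (n i - k i)
        / ep 1 (int (n i) - int (n i - k i) + 1 - int (k i)) (n i - k i)"
      unfolding T_def using ep_ratio_reflect [of 1 "int (k i)" "n i - k i" "int (n i)"] reg(1) [OF i] by simp
    also have "\<dots> = ep 1 (1 + int (k i)) (n i - k i) / ep 1 1 (n i - k i)"
      using le [OF i] by (simp add: of_nat_diff add.commute)
    also have "ep 1 (1 + int (k i)) (n i - k i) = ep 1 1 (n i) / ep 1 1 (k i)"
    proof -
      have "ep 1 1 (k i + l) = ep 1 1 (k i) * ep 1 (1 + int (k i)) l" for l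
        by (induction l) (simp_all add: ep_Suc add_ac)
      from this [of "n i - k i"] show ?thesis
        using le [OF i] ep0 [of "k i"] n_le by simp
    qed
    finally show ?thesis
      by simp
  qed
  have pair: "T i j * T j i = q ^ (k j * (n i - k i))
      * (c i j (- int (k i)) / c i j (- int (n i)) / (c i j (- int (k i) + int (k j)) / c i j (- int (n i) + int (k j))))
      * (c i j (1 + int (n j)) / c i j (1 + int (k j)) / (c i j (1 - int (k i) + int (n j)) / c i j (1 - int (k i) + int (k j))))"
    if ij: "j \<in> {1..r}" "i \<in> {1..<j}" for i j
  proof -
    have i: "i \<in> {1..r}" "i \<noteq> j"
      using ij by auto
    note ep_c = ep_primitive [OF reg(3) [OF i(1) ij(1) i(2)], folded c_def [THEN fun_cong, THEN fun_cong]]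
    have l: "int (n i - k i) = int (n i) - int (k i)" "int (n j - k j) = int (n j) - int (k j)"
      using le i(1) ij(1) by auto
    have "T i j = q ^ (k j * (n i - k i))
      * (c i j (- int (k i)) / c i j (- int (n i)) / (c i j (- int (k i) + int (k j)) / c i j (- int (n i) + int (k j))))"
      unfolding T_def ep_c l by (simp add: algebra_simps)
    moreover have "T j i = c i j (1 + int (n j)) / c i j (1 + int (k j))
        / (c i j (1 - int (k i) + int (n j)) / c i j (1 - int (k i) + int (k j)))"
    proof -
      have "q ^ (k i * (n j - k j)) = q powi (int (k i) * int (n j - k j))"
        by (metis of_nat_mult power_int_of_nat)
      then have "T j i = ep (a i / a j) (int (n j) - int (n j - k j) + 1) (n j - k j)
          / ep (a i / a j) (int (n j) - int (n j - k j) + 1 - int (k i)) (n j - k j)"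
        unfolding T_def
        using ep_ratio_reflect [of "a i / a j" "int (k i)" "n j - k j" "int (n j)"] reg(1) i ij by simp
      then show ?thesis
        unfolding ep_c l by (simp add: algebra_simps)
    qed
    ultimately show ?thesis
      by (simp only: mult.assoc)
  qed

  have singles: "P (\<lambda>i. primitive (a i) (1 + int M) / primitive (a i) (1 + int M - int (k i))
        / (primitive (a i) (1 + 2 * Ks (i - 1) + int (k i)) / primitive (a i) (1 + 2 * Ks (i - 1))))
    * P (\<lambda>i. primitive (a i) (1 + int N + int M - int (k i)) / primitive (a i) (1 + int N + int M - int (n i))
        / (primitive (a i) (2 * (Ns (i - 1) + int M - Ks i) + 1 + int (n i))
           / primitive (a i) (2 * (Ns (i - 1) + int M - Ks i) + 1 + int (k i))))
    * P (\<lambda>i. g i (Ns (i - 1) + int M - Ks i) / g i (Ns (i - 1)) * (h i (Ns (i - 1)) / h i (Ks (i - 1))))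
    = P (\<lambda>i. primitive (a i) (1 + int N) / primitive (a i) (1 + int N - int (n i))
        / (primitive (a i) (1 + 2 * Ns (i - 1) + int (n i)) / primitive (a i) (1 + 2 * Ns (i - 1)))) * P S"
    unfolding P_mult
  proof (rule P_cong)
    fix i assume i: "i \<in> {1..r}"
    have comm: "2 * u + 1 + v = 1 + 2 * u + v" "2 * u + 1 = 1 + 2 * u" for u v :: int
      by simp_all
    show "primitive (a i) (1 + int M) / primitive (a i) (1 + int M - int (k i))
        / (primitive (a i) (1 + 2 * Ks (i - 1) + int (k i)) / primitive (a i) (1 + 2 * Ks (i - 1)))
      * (primitive (a i) (1 + int N + int M - int (k i)) / primitive (a i) (1 + int N + int M - int (n i))
        / (primitive (a i) (2 * (Ns (i - 1) + int M - Ks i) + 1 + int (n i))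
           / primitive (a i) (2 * (Ns (i - 1) + int M - Ks i) + 1 + int (k i))))
      * (g i (Ns (i - 1) + int M - Ks i) / g i (Ns (i - 1)) * (h i (Ns (i - 1)) / h i (Ks (i - 1))))
      = primitive (a i) (1 + int N) / primitive (a i) (1 + int N - int (n i))
        / (primitive (a i) (1 + 2 * Ns (i - 1) + int (n i)) / primitive (a i) (1 + 2 * Ns (i - 1))) * S i"
      unfolding g_def h_def S_def comm using prim0 [OF i] by (simp add: divide_simps)
  qed
  have pairs: "PP (\<lambda>i j. c i j (1 - int (k i) + int (k j)) / c i j (1 - int (k i)) / (c i j (1 + int (k j)) / c i j 1))
    * PP (\<lambda>i j. c i j (1 - int (n i) + int (n j)) / c i j (1 - int (n i) + int (k j))
        / (c i j (1 - int (k i) + int (n j)) / c i j (1 - int (k i) + int (k j)))) * PP C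
    = PP (\<lambda>i j. c i j (1 - int (n i) + int (n j)) / c i j (1 - int (n i)) / (c i j (1 + int (n j)) / c i j 1))
    * PP (\<lambda>i j. T i j * T j i)"
    unfolding PP_mult
  proof (rule PP_cong)
    fix i j assume ij: "j \<in> {1..r}" "i \<in> {1..<j}"
    show "c i j (1 - int (k i) + int (k j)) / c i j (1 - int (k i)) / (c i j (1 + int (k j)) / c i j 1)
      * (c i j (1 - int (n i) + int (n j)) / c i j (1 - int (n i) + int (k j))
        / (c i j (1 - int (k i) + int (n j)) / c i j (1 - int (k i) + int (k j)))) * C i j
      = c i j (1 - int (n i) + int (n j)) / c i j (1 - int (n i)) / (c i j (1 + int (n j)) / c i j 1)
      * (T i j * T j i)"
      unfolding C_def pair [OF ij] using c0 [OF ij] by (simp add: divide_simps)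
  qed
  have diags: "P (\<lambda>i. T i i) = P (\<lambda>i. ep 1 1 (n i)) / (P (\<lambda>i. ep 1 1 (k i)) * P (\<lambda>i. ep 1 1 (n i - k i)))"
    unfolding P_mult unfolding P_def prod_dividef [symmetric] by (intro prod.cong refl diag)
  have P_ep0: "P (\<lambda>i. ep 1 1 (n i)) \<noteq> 0"
    unfolding P_def using ep0 sums(2) by (auto simp: prod_zero_iff) (meson atLeastAtMost_iff finite_atLeastAtMost member_le_sum zero_le)
  define XM XN XD where "XM = ep 1 1 M" and "XN = ep 1 1 N" and "XD = ep 1 1 (N - M)"
  have XN0: "XN \<noteq> 0"
    unfolding XN_def by (rule ep0) simp
  have reorder: "(XM / Pk * A1 * B1) * (XD / Pd * A2 * B2) * (A3 * B3) =
      (XN / Pn * A4 * B4) * (XM * XD / XN * A5 * (Pn / (Pk * Pd) * B5))"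
    if "A1 * A2 * A3 = A4 * A5" "B1 * B2 * B3 = B4 * B5" "Pn \<noteq> 0" "XN \<noteq> 0"
    for Pk Pd Pn A1 A2 A3 A4 A5 B1 B2 B3 B4 B5
  proof -
    have "(XM / Pk * A1 * B1) * (XD / Pd * A2 * B2) * (A3 * B3) =
        XM * XD / (Pk * Pd) * (A1 * A2 * A3) * (B1 * B2 * B3)"
      by simp
    also have "\<dots> = (XN / Pn * A4 * B4) * (XM * XD / XN * A5 * (Pn / (Pk * Pd) * B5))"
      unfolding that(1,2) using that(3,4) by simp
    finally show ?thesis .
  qed
  have "conv_term r a q p M n k = emultinom r a q p (\<lambda>i. int (k i))
     * emultinom r (shifted_params a q M k) q p (\<lambda>i. int (n i) - int (k i))
     * (\<Prod>j=1..r. \<Prod>i\<in>{1..<j}. bigQ (a i) (a j) q p (n i - k i) (Ns (i - 1) + Ks (j - 1) - Ks i) (int (k i)) (k j))"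
    unfolding conv_term_def Ns_def Ks_def ..
  then show ?thesis
    unfolding Q c_n c_k c_nk tr diags XM_def [symmetric] XN_def [symmetric] XD_def [symmetric]
    by (rule trans) (rule reorder [OF singles pairs P_ep0 XN0])
qed

end

section \<open>Passage to all regular parameters\<close>

context nome_base
begin

lemma convolution_generic:
  assumes gen: "generic r a" and n: "(\<Sum>i=1..r. n i) = N" and "M \<le> N"
    and qs: "\<And>s. 1 \<le> s \<Longrightarrow> s \<le> N \<Longrightarrow> th 1 (int s) \<noteq> 0"
  shows "emultinom r a q p (\<lambda>i. int (n i)) = (\<Sum>k\<in>compositions r M. conv_term r a q p M n k)"
proof -
  define S where "S = {k. k \<in> compositions r M \<and> (\<forall>i\<in>{1..r}. k i \<le> n i)}"
  have "(\<Sum>k\<in>compositions r M. conv_term r a q p M n k) = (\<Sum>k\<in>S. conv_term r a q p M n k)"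
  proof (rule sum.mono_neutral_right [OF finite_compositions])
    show "\<forall>k\<in>compositions r M - S. conv_term r a q p M n k = 0"
      by (auto simp: S_def conv_term_def emultinom_def not_le)
  qed (auto simp: S_def)
  also have "\<dots> = (\<Sum>k\<in>S. emultinom r a q p (\<lambda>i. int (n i)) * transition r a k n)"
  proof (intro sum.cong refl)
    fix k assume "k \<in> S"
    then have "(\<Sum>i=1..r. k i) = M" "\<And>i. i \<in> {1..r} \<Longrightarrow> k i \<le> n i"
      by (auto simp: S_def compositions_def)
    then show "conv_term r a q p M n k = emultinom r a q p (\<lambda>i. int (n i)) * transition r a k n"
      using gen n qs by (intro conv_term_generic)
  qed
  also have "\<dots> = emultinom r a q p (\<lambda>i. int (n i)) * (\<Sum>k\<in>S. transition r a k n)"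
    by (rule sum_distrib_left [symmetric])
  also have "(\<Sum>k\<in>S. transition r a k n) = 1"
    unfolding S_def using gen by (rule sum_transition) (use n qs \<open>M \<le> N\<close> in simp_all)
  finally show ?thesis
    by simp
qed

lemma tendsto_epoch:
  assumes "(f \<longlongrightarrow> x) F" "x \<noteq> 0"
  shows "((\<lambda>t. epoch (f t) q p l) \<longlongrightarrow> epoch x q p l) F"
  unfolding epoch_def using assms q_nonzero
  by (intro tendsto_prod tendsto_theta tendsto_mult tendsto_const) auto

lemma tendsto_emultinom:
  assumes A: "\<And>i. i \<in> {1..r} \<Longrightarrow> ((\<lambda>t. A t i) \<longlongrightarrow> a i) F" "\<And>i. i \<in> {1..r} \<Longrightarrow> a i \<noteq> 0"
    and reg: "emultinom_regular r a q p k"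
  shows "((\<lambda>t. emultinom r (A t) q p k) \<longlongrightarrow> emultinom r a q p k) F"
proof (cases "\<exists>j\<in>{1..r}. k j < 0")
  case True
  then show ?thesis
    by (simp add: emultinom_def)
next
  case False
  have "((\<lambda>t. epoch q q p (nat (psum k r)) / (\<Prod>i=1..r. epoch q q p (nat (k i)))
       * (\<Prod>i=1..r. epoch (A t i * q powi (1 + psum k r - k i)) q p (nat (k i))
                   / epoch (A t i * q powi (1 + 2 * psum k (i - 1))) q p (nat (k i)))
       * (\<Prod>j=1..r. \<Prod>i\<in>{1..<j}.
            epoch (A t i * q powi (1 - k i) / A t j) q p (nat (k j))
            / epoch (A t i * q / A t j) q p (nat (k j)))) \<longlongrightarrow>
      epoch q q p (nat (psum k r)) / (\<Prod>i=1..r. epoch q q p (nat (k i)))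
       * (\<Prod>i=1..r. epoch (a i * q powi (1 + psum k r - k i)) q p (nat (k i))
                   / epoch (a i * q powi (1 + 2 * psum k (i - 1))) q p (nat (k i)))
       * (\<Prod>j=1..r. \<Prod>i\<in>{1..<j}.
            epoch (a i * q powi (1 - k i) / a j) q p (nat (k j))
            / epoch (a i * q / a j) q p (nat (k j)))) F"
  proof (intro tendsto_mult tendsto_prod tendsto_const)
    fix i assume i: "i \<in> {1..r}"
    show "((\<lambda>t. epoch (A t i * q powi (1 + psum k r - k i)) q p (nat (k i))
                   / epoch (A t i * q powi (1 + 2 * psum k (i - 1))) q p (nat (k i))) \<longlongrightarrow>
      epoch (a i * q powi (1 + psum k r - k i)) q p (nat (k i))
                   / epoch (a i * q powi (1 + 2 * psum k (i - 1))) q p (nat (k i))) F"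
    proof (rule tendsto_divide)
      show "epoch (a i * q powi (1 + 2 * psum k (i - 1))) q p (nat (k i)) \<noteq> 0"
        using reg i unfolding emultinom_regular_def by blast
    qed (use A i q_nonzero in \<open>intro tendsto_epoch tendsto_mult tendsto_const; simp\<close>)+
  next
    fix j i assume j: "j \<in> {1..r}" and i': "i \<in> {1..<j}"
    then have i: "i \<in> {1..r}"
      by auto
    show "((\<lambda>t. epoch (A t i * q powi (1 - k i) / A t j) q p (nat (k j))
            / epoch (A t i * q / A t j) q p (nat (k j))) \<longlongrightarrow>
      epoch (a i * q powi (1 - k i) / a j) q p (nat (k j)) / epoch (a i * q / a j) q p (nat (k j))) F"
    proof (rule tendsto_divide)
      show "epoch (a i * q / a j) q p (nat (k j)) \<noteq> 0"
        using reg i' j unfolding emultinom_regular_def by blast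
    qed (use A i j q_nonzero in \<open>intro tendsto_epoch tendsto_divide tendsto_mult tendsto_const; simp\<close>)+
  qed
  then show ?thesis
    unfolding emultinom_def if_not_P [OF False] .
qed

lemma tendsto_bigQ:
  assumes "(A \<longlongrightarrow> a) F" "(B \<longlongrightarrow> b) F" "a \<noteq> 0" "b \<noteq> 0" and reg: "bigQ_regular a b q p l \<rho> s t"
  shows "((\<lambda>x. bigQ (A x) (B x) q p l \<rho> s t) \<longlongrightarrow> bigQ a b q p l \<rho> s t) F"
  unfolding bigQ_def eW_shift_def eW_def
proof (intro tendsto_prod)
  fix i j assume "i \<in> {1..l}" "j \<in> {1..t}"
  then have "ew_regular (a * q powi (2 * \<rho>)) (b * q powi (2 * \<rho>)) q p (int i + s) (int j)"
    using reg unfolding bigQ_regular_def by blast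
  then show "((\<lambda>x. ew (A x * q powi (2 * \<rho>)) (B x * q powi (2 * \<rho>)) q p (int i + s) (int j)) \<longlongrightarrow>
      ew (a * q powi (2 * \<rho>)) (b * q powi (2 * \<rho>)) q p (int i + s) (int j)) F"
    unfolding ew_def ew_regular_def thetas_def list.map prod_list.Cons prod_list.Nil
    using assms(1-4) q_nonzero
    by (intro tendsto_mult tendsto_divide tendsto_theta tendsto_const) auto
qed

lemma tendsto_conv_term:
  assumes A: "\<And>i. i \<in> {1..r} \<Longrightarrow> ((\<lambda>t. A t i) \<longlongrightarrow> a i) F" and nz: "\<And>i. i \<in> {1..r} \<Longrightarrow> a i \<noteq> 0"
    and reg: "(\<And>i. i \<in> {1..r} \<Longrightarrow> k i \<le> n i) \<Longrightarrow> conv_term_regular r a q p M n k"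
  shows "((\<lambda>t. conv_term r (A t) q p M n k) \<longlongrightarrow> conv_term r a q p M n k) F"
proof (cases "\<exists>i\<in>{1..r}. n i < k i")
  case True
  then have "conv_term r b q p M n k = 0" for b
    by (auto simp: conv_term_def emultinom_def)
  then show ?thesis
    by simp
next
  case False
  then have reg': "conv_term_regular r a q p M n k"
    by (intro reg) (auto simp: not_less)
  show ?thesis
    unfolding conv_term_def
  proof (intro tendsto_mult tendsto_prod)
    show "((\<lambda>t. emultinom r (A t) q p (\<lambda>i. int (k i))) \<longlongrightarrow> emultinom r a q p (\<lambda>i. int (k i))) F"
      using A nz reg' unfolding conv_term_regular_def by (intro tendsto_emultinom) auto
    show "((\<lambda>t. emultinom r (shifted_params (A t) q M k) q p (\<lambda>i. int (n i) - int (k i))) \<longlongrightarrow>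
        emultinom r (shifted_params a q M k) q p (\<lambda>i. int (n i) - int (k i))) F"
    proof (rule tendsto_emultinom)
      show "((\<lambda>t. shifted_params (A t) q M k i) \<longlongrightarrow> shifted_params a q M k i) F" if "i \<in> {1..r}" for i
        unfolding shifted_params_def using A [OF that] by (intro tendsto_mult tendsto_const)
      show "shifted_params a q M k i \<noteq> 0" if "i \<in> {1..r}" for i
        using nz [OF that] q_nonzero by (simp add: shifted_params_def)
    qed (use reg' in \<open>simp add: conv_term_regular_def\<close>)
  next
    fix j i assume "j \<in> {1..r}" "i \<in> {1..<j}"
    then show "((\<lambda>t. bigQ (A t i) (A t j) q p (n i - k i)
            (psum (\<lambda>\<nu>. int (n \<nu>)) (i - 1) + psum (\<lambda>\<nu>. int (k \<nu>)) (j - 1) - psum (\<lambda>\<nu>. int (k \<nu>)) i)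
            (int (k i)) (k j)) \<longlongrightarrow> bigQ (a i) (a j) q p (n i - k i)
            (psum (\<lambda>\<nu>. int (n \<nu>)) (i - 1) + psum (\<lambda>\<nu>. int (k \<nu>)) (j - 1) - psum (\<lambda>\<nu>. int (k \<nu>)) i)
            (int (k i)) (k j)) F"
      using A nz reg' unfolding conv_term_regular_def by (intro tendsto_bigQ) auto
  qed
qed

text \<open>
  The exponents \<open>i\<close> are nonzero and distinct, so each of the countably many theta factors along the
  curve, including those of the ratios, vanishes for countably many \<open>t\<close> only.
\<close>

lemma countable_nongeneric:
  assumes "\<And>i. i \<in> {1..r} \<Longrightarrow> a i \<noteq> 0"
  shows "countable {t :: real. \<not> generic r (\<lambda>i. a i * of_real (exp (real i * t)))}"
proof -
  define Z where "Z = (\<lambda>c w. {t :: real. theta p (c * of_real (exp (w * t))) = 0})"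
  have Z: "countable (Z c w)" if "c \<noteq> 0" "w \<noteq> 0" for c w
    unfolding Z_def using that by (rule countable_theta_exp_zeros)
  define B where "B = (\<Union>i\<in>{1..r}. \<Union>s. Z (a i * q powi s) (real i)) \<union>
      (\<Union>i\<in>{1..r}. \<Union>j\<in>{1..r} - {i}. \<Union>s. Z (a i / a j * q powi s) (real i - real j))"
  have "countable B"
    unfolding B_def using assms q_nonzero by (intro countable_Un countable_UN Z) auto
  moreover have "generic r (\<lambda>i. a i * of_real (exp (real i * t)))" if "t \<notin> B" for t
    unfolding generic_def
  proof (intro conjI ballI allI impI)
    fix i s assume i: "i \<in> {1..r}"
    show "a i * of_real (exp (real i * t)) \<noteq> 0"
      using assms [OF i] by simp
    show "th (a i * of_real (exp (real i * t))) s \<noteq> 0"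
      using that i by (auto simp: B_def Z_def th_def mult_ac)
    fix j assume j: "j \<in> {1..r}" "i \<noteq> j"
    have "a i * of_real (exp (real i * t)) / (a j * of_real (exp (real j * t))) * q powi s
        = a i / a j * q powi s * of_real (exp ((real i - real j) * t))"
      by (simp add: left_diff_distrib exp_diff)
    then show "th (a i * of_real (exp (real i * t)) / (a j * of_real (exp (real j * t)))) s \<noteq> 0"
      using that i j by (auto simp: B_def Z_def th_def)
  qed
  then have "{t. \<not> generic r (\<lambda>i. a i * of_real (exp (real i * t)))} \<subseteq> B"
    by auto
  ultimately show ?thesis
    by (rule countable_subset [rotated])
qed

end

theorem theorem5p1:
  fixes r M N :: nat and q p :: complex and a :: "nat \<Rightarrow> complex" and n :: "nat \<Rightarrow> nat"
  assumes "r > 1"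
    and "q \<noteq> 0" and "p \<noteq> 0" and "norm p < 1"
    and "M \<le> N"
    and "(\<Sum>i=1..r. n i) = N"
    and "\<And>m. 1 \<le> m \<Longrightarrow> m \<le> N \<Longrightarrow> theta p (q ^ m) \<noteq> 0"
    and "\<And>i. i \<in> {1..r} \<Longrightarrow> a i \<noteq> 0"
    and "emultinom_regular r a q p (\<lambda>i. int (n i))"
    and "\<And>k. k \<in> compositions r M \<Longrightarrow> (\<And>i. i \<in> {1..r} \<Longrightarrow> k i \<le> n i)
           \<Longrightarrow> conv_term_regular r a q p M n k"
  shows "emultinom r a q p (\<lambda>i. int (n i)) = (\<Sum>k\<in>compositions r M. conv_term r a q p M n k)"
proof -
  interpret nome_base p q
    by unfold_locales (use assms in auto)
  define A where "A = (\<lambda>t i. a i * complex_of_real (exp (real i * t)))"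
  have A0: "A 0 = a"
    by (simp add: A_def)
  have A_lim: "((\<lambda>t. A t i) \<longlongrightarrow> A 0 i) (at 0)" for i
    unfolding A_def by (intro tendsto_mult tendsto_const tendsto_of_real tendsto_exp tendsto_ident_at)
  have "emultinom r (A 0) q p (\<lambda>i. int (n i)) = (\<Sum>k\<in>compositions r M. conv_term r (A 0) q p M n k)"
  proof (rule eq_at_0_if_eq_off_countable [where f = "\<lambda>t. emultinom r (A t) q p (\<lambda>i. int (n i))"
        and g = "\<lambda>t. \<Sum>k\<in>compositions r M. conv_term r (A t) q p M n k"])
    show "countable {t. \<not> generic r (A t)}"
      unfolding A_def using assms(8) by (rule countable_nongeneric)
    show "emultinom r (A t) q p (\<lambda>i. int (n i)) = (\<Sum>k\<in>compositions r M. conv_term r (A t) q p M n k)"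
      if "t \<notin> {t. \<not> generic r (A t)}" for t
      using that assms(5-7) by (intro convolution_generic) (auto simp: th_def)
    show "((\<lambda>t. emultinom r (A t) q p (\<lambda>i. int (n i))) \<longlongrightarrow> emultinom r (A 0) q p (\<lambda>i. int (n i))) (at 0)"
      using A_lim assms(8,9) by (intro tendsto_emultinom) (auto simp: A0)
    show "((\<lambda>t. \<Sum>k\<in>compositions r M. conv_term r (A t) q p M n k) \<longlongrightarrow>
        (\<Sum>k\<in>compositions r M. conv_term r (A 0) q p M n k)) (at 0)"
      using A_lim assms(8,10) by (intro tendsto_sum tendsto_conv_term) (auto simp: A0)
  qed
  then show ?thesis
    by (simp add: A0)
qed

end
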